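(* Let $n\ge 2$, let $c\ge 1$, let $D\subset\mathbb{R}^n$ be an unbounded $c$-John domain, let $\tau,\delta\in(0,1)$, and let $1\le p<n/\delta$. Then there is a constant $C=C(\delta,\tau,p,n,c)>0$, depending only on the quantities $\delta,\tau,p,n,c$, such that the inequality $$\int_D |u(x)|^{np/(n-\delta p)}\,dx\le C\,|u|_{W^{\delta,p}_\tau(D)}^{np/(n-\delta p)}$$ holds for each $u\in\dot{W}^{\delta,p}_\tau(D)$ with a compact support in $D$.
   Context: A domain $D$ in $\mathbb{R}^n$ with $n\ge2$ is a $c$-John domain, $c\ge1$, if each pair of points $x_1,x_2\in D$ can be joined by a rectifiable curve $\gamma:[0,\ell]\to D$ parametrized by its arc length (so $\gamma(0)=x_1$, $\gamma(\ell)=x_2$) such that $\mathrm{dist}(\gamma(t),\partial D)\ge\min\{t,\ell-t\}/c$ for every $t\in[0,\ell]$. Unbounded domains, including $\mathbb{R}^n$, are allowed. $B^n(x,r)$ is the open ball with center $x$ and radius $r$. For an open set $G\subset\mathbb{R}^n$, $0<p<\infty$, $0<\tau,\delta<1$ and a measurable $u:G\to\mathbb{R}$, $$|u|_{W^{\delta,p}_\tau(G)}=\Big(\int_G\int_{B^n(x,\tau\,\mathrm{dist}(x,\partial G))}\frac{|u(x)-u(y)|^p}{|x-y|^{n+\delta p}}\,dy\,dx\Big)^{1/p};$$ when $G=\mathbb{R}^n$ both integrals are taken over the whole space. The homogeneous fractional Sobolev space $\dot{W}^{\delta,p}_\tau(G)$ consists of all measurable $u:G\to\mathbb{R}$ with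 $|u|_{W^{\delta,p}_\tau(G)}<\infty$. *)

theory Defs
  imports "HOL-Analysis.Analysis"
begin

(* Extended-real valued because dist(x, {}) must be \<infinity> when G is the whole space,
   whereas infdist x {} = 0. *)
definition boundary_dist :: "(real^'n) set \<Rightarrow> real^'n \<Rightarrow> ereal" where
  "boundary_dist G x = (if frontier G = {} then \<infinity> else ereal (infdist x (frontier G)))"

definition curve_length :: "(real \<Rightarrow> real^'n) \<Rightarrow> real \<Rightarrow> real \<Rightarrow> ennreal" where
  "curve_length \<gamma> a b =
     (SUP (N, s) \<in> {(N :: nat, s :: nat \<Rightarrow> real). mono s \<and> range s \<subseteq> {a..b}}.
        ennreal (\<Sum>i<N. dist (\<gamma> (s i)) (\<gamma> (s (Suc i)))))"

(* Rectifiability is implied: the curve has total length L < \<infinity>. *)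
definition arc_length_param :: "(real \<Rightarrow> real^'n) \<Rightarrow> real \<Rightarrow> bool" where
  "arc_length_param \<gamma> L \<longleftrightarrow>
     0 \<le> L \<and> continuous_on {0..L} \<gamma> \<and> (\<forall>t\<in>{0..L}. curve_length \<gamma> 0 t = ennreal t)"

definition john_domain :: "real \<Rightarrow> (real^'n) set \<Rightarrow> bool" where
  "john_domain c D \<longleftrightarrow>
     open D \<and> connected D \<and> D \<noteq> {} \<and>
     (\<forall>x1\<in>D. \<forall>x2\<in>D. \<exists>\<gamma> L.
        arc_length_param \<gamma> L \<and> \<gamma> ` {0..L} \<subseteq> D \<and> \<gamma> 0 = x1 \<and> \<gamma> L = x2 \<and>
        (\<forall>t\<in>{0..L}. ereal (min t (L - t) / c) \<le> boundary_dist D (\<gamma> t)))"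

(* The p-th power of the seminorm. The inner domain of integration is the ball
   B(x, \<tau> dist(x, boundary of G)), which is the whole space if G is. *)
definition frac_energy ::
    "real \<Rightarrow> real \<Rightarrow> real \<Rightarrow> (real^'n) set \<Rightarrow> (real^'n \<Rightarrow> real) \<Rightarrow> ennreal" where
  "frac_energy \<tau> \<delta> p G u =
     (\<integral>\<^sup>+x\<in>G. (\<integral>\<^sup>+y\<in>{y. ereal (dist x y) < ereal \<tau> * boundary_dist G x}.
        ennreal (\<bar>u x - u y\<bar> powr p / norm (x - y) powr (real CARD('n) + \<delta> * p))
        \<partial>lebesgue) \<partial>lebesgue)"

definition frac_seminorm ::
    "real \<Rightarrow> real \<Rightarrow> real \<Rightarrow> (real^'n) set \<Rightarrow> (real^'n \<Rightarrow> real) \<Rightarrow> ennreal" where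
  "frac_seminorm \<tau> \<delta> p G u =
     (if frac_energy \<tau> \<delta> p G u = \<infinity> then \<infinity>
      else ennreal (enn2real (frac_energy \<tau> \<delta> p G u) powr (1 / p)))"

(* Functions on G are represented by total functions whose values outside G are irrelevant. *)
definition frac_sobolev ::
    "real \<Rightarrow> real \<Rightarrow> real \<Rightarrow> (real^'n) set \<Rightarrow> (real^'n \<Rightarrow> real) set" where
  "frac_sobolev \<tau> \<delta> p G =
     {u. u \<in> borel_measurable (lebesgue_on G) \<and> frac_seminorm \<tau> \<delta> p G u < \<infinity>}"

definition compact_support_in :: "(real^'n) set \<Rightarrow> (real^'n \<Rightarrow> real) \<Rightarrow> bool" where
  "compact_support_in G u \<longleftrightarrow>
     compact (closure {x\<in>G. u x \<noteq> 0}) \<and> closure {x\<in>G. u x \<noteq> 0} \<subseteq> G"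

end

theory Submission
  imports Defs "HOL-Library.Nat_Bijection"
begin

text \<open>
Write \<open>q = n p / (n - \<delta> p)\<close> and let
\<open>g(x) = \<integral> |u(x) - u(y)|\<^sup>p / |x - y|\<^bsup>n + \<delta> p\<^esup> dy\<close>, the integral being over the ball
\<open>B(x, \<tau> dist(x, \<partial>D))\<close>, so that \<open>\<integral> g\<close> over \<open>D\<close> is the \<open>p\<close>-th power \<open>E\<close> of the seminorm.

The John condition is used only to travel from a point to infinity.  Given \<open>x\<close> in \<open>D\<close>, the first half of
a John curve from \<open>x\<close> to a very distant point carries balls of radii
\<open>\<kappa> \<rho>\<^sub>i\<close>, where \<open>\<rho>\<^sub>i = r (1 + \<kappa>)\<^sup>i\<close>, with centers within distance
\<open>\<rho>\<^sub>i\<close> of \<open>x\<close> and so far inside \<open>D\<close> that each ball lies in the domain of integration of \<open>g(y)\<close> for every \<open>y\<close> in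
the preceding ball (\<open>john_domain_ball_chain\<close>).  Consequently the averages of \<open>u\<close> over two consecutive
balls differ by at most a constant times
\<open>\<rho>\<^sub>i\<^bsup>\<delta>\<^esup>\<close> times the \<open>p\<close>-th root of \<open>\<rho>\<^sub>i\<^bsup>-n\<^esup> \<integral> g\<close>, the integral
being over the first ball (\<open>averages_near_each_other\<close>), and \<open>|u(x)|\<close> is bounded by the sum of these
differences, because the averages over very large balls are negligible when \<open>u\<close> is bounded and its support
has finite measure.

Now let \<open>0 \<le> u \<le> t\<close> and choose the scale \<open>R\<close> by \<open>R\<^bsup>n - \<delta> p\<^esup> \<approx> E / t\<^sup>p\<close>.  The balls
with \<open>\<rho>\<^sub>i > R\<close> contribute less than a fixed fraction of \<open>t\<close>, by the bound \<open>\<integral> g \<le> E\<close>.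
If \<open>u(x) = t\<close>, then some ball of scale \<open>\<rho> \<le> R\<close> must carry much mass:
\<open>\<integral> g \<ge> \<alpha> \<rho>\<^sup>n\<close> over \<open>B(x, 2 \<rho>)\<close>, or \<open>g(x) \<ge> \<alpha>\<close>, where
\<open>\<alpha> \<approx> t\<^sup>p R\<^bsup>-\<delta> p\<^esup>\<close> (\<open>value_less_of_small_densities\<close>).
The Vitali covering lemma and the Markov inequality bound the measure of the set of such points by
a multiple of \<open>\<alpha>\<^bsup>-1\<^esup> \<integral> g\<close>.  This is a weak-type bound for every \<open>p \<ge> 1\<close>, the
endpoint \<open>p = 1\<close> included (\<open>weak_type_estimate\<close>).

To reach the strong inequality, cut \<open>|u|\<close> into its dyadic bands
\<open>u\<^sub>k = min (max (|u| - 2\<^sup>k) 0) 2\<^sup>k\<close> for integers \<open>k\<close>, in the manner of Maz'ya.  Each \<open>u\<^sub>k\<close> equals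
\<open>2\<^sup>k\<close> where \<open>|u| \<ge> 2\<^bsup>k + 1\<^esup>\<close>.  The bands are nonoverlapping
pieces of \<open>|u|\<close>, and \<open>p \<ge> 1\<close>, so the energies of the \<open>u\<^sub>k\<close> add up to at most \<open>E\<close>.  Summing the weak
estimates of the bands, multiplied by \<open>2\<^bsup>k q\<^esup>\<close>, gives the claim
(\<open>sobolev_inequality_of_ball_chains\<close>).
\<close>

section \<open>Averages and the fractional density\<close>

text \<open>
The inner integral of the energy.  The neighbourhoods \<open>N x\<close> and the exponent \<open>a\<close> are arbitrary here; the
inequality uses balls of radius \<open>\<tau> dist(x, \<partial>D)\<close> and \<open>a = n + \<delta> p\<close>.
\<close>
definition frac_density ::
    "('a::euclidean_space \<Rightarrow> 'a set) \<Rightarrow> real \<Rightarrow> real \<Rightarrow> ('a \<Rightarrow> real) \<Rightarrow> 'a \<Rightarrow> ennreal" where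
  "frac_density N a p f x =
     (\<integral>\<^sup>+y\<in>N x. ennreal (\<bar>f x - f y\<bar> powr p / norm (x - y) powr a) \<partial>lborel)"

lemma borel_measurable_frac_density [measurable]:
  fixes f :: "'a::euclidean_space \<Rightarrow> real"
  assumes [measurable]: "f \<in> borel_measurable borel"
    and N: "{(x, y). y \<in> N x} \<in> sets (borel \<Otimes>\<^sub>M borel)"
  shows "frac_density N a p f \<in> borel_measurable borel"
proof -
  have [measurable]: "Measurable.pred (borel \<Otimes>\<^sub>M borel) (\<lambda>z. snd z \<in> N (fst z))"
    using N by (simp add: pred_def case_prod_beta' space_pair_measure)
  have "(\<lambda>x. \<integral>\<^sup>+y. ennreal (\<bar>f x - f y\<bar> powr p / norm (x - y) powr a) *
      (if snd (x, y) \<in> N (fst (x, y)) then 1 else 0) \<partial>lborel) \<in> borel_measurable borel"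
    by measurable
  then show ?thesis
    unfolding frac_density_def[abs_def] by (simp add: indicator_def[abs_def] of_bool_def)
qed

definition average :: "('a::euclidean_space \<Rightarrow> real) \<Rightarrow> 'a set \<Rightarrow> real" where
  "average f B = (LINT x:B|lborel. f x) / measure lborel B"

lemma average_deviation_le:
  fixes f :: "'a::euclidean_space \<Rightarrow> real"
  assumes f: "set_integrable lborel B f" and B: "B \<in> sets borel" "emeasure lborel B < \<infinity>"
    and pos: "0 < measure lborel B"
  shows "ennreal (\<bar>c - average f B\<bar> * measure lborel B) \<le> (\<integral>\<^sup>+x\<in>B. ennreal \<bar>c - f x\<bar> \<partial>lborel)"
proof -
  have c: "set_integrable lborel B (\<lambda>_. c)"
    using B by (simp add: set_integrable_def)
  have i: "integrable lborel (\<lambda>x. indicator B x *\<^sub>R (c - f x))"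
    using set_integral_diff(1)[OF c f] by (simp add: set_integrable_def)
  have "(c - average f B) * measure lborel B = (LINT x:B|lborel. c - f x)"
    using pos B set_integral_diff(2)[OF c f]
    by (simp add: average_def algebra_simps set_lebesgue_integral_def)
  then have "\<bar>c - average f B\<bar> * measure lborel B = norm (LINT x:B|lborel. c - f x)"
    using pos by (metis abs_mult abs_of_pos real_norm_def)
  also have "ennreal \<dots> \<le> (\<integral>\<^sup>+x. ennreal (norm (indicator B x *\<^sub>R (c - f x))) \<partial>lborel)"
    unfolding set_lebesgue_integral_def using integral_norm_bound_ennreal[OF i] by simp
  also have "\<dots> = (\<integral>\<^sup>+x\<in>B. ennreal \<bar>c - f x\<bar> \<partial>lborel)"
    by (intro nn_integral_cong) (auto simp: indicator_def)
  finally show ?thesis .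
qed

text \<open>
Substitute for the Jensen inequality: integrating this bound shows that a function whose \<open>p\<close>-th power has mean
at most \<open>l\<^sup>p\<close> has mean at most \<open>2 l\<close>.
\<close>
lemma le_threshold_plus_powr:
  fixes x l p :: real
  assumes "0 \<le> x" "0 < l" "1 \<le> p"
  shows "x \<le> l + l powr (1 - p) * x powr p"
proof (cases "x \<le> l")
  case False
  then have "l powr (p - 1) \<le> x powr (p - 1)"
    using assms by (intro powr_mono2) auto
  then have "x * (l powr (1 - p) * l powr (p - 1)) \<le> x * (l powr (1 - p) * x powr (p - 1))"
    using assms by (intro mult_left_mono) auto
  moreover have "l powr (1 - p) * l powr (p - 1) = 1"
    using assms by (simp add: powr_add[symmetric])
  moreover have "x * x powr (p - 1) = x powr p"
    using assms False by (simp add: powr_mult_base)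
  ultimately have "x \<le> l powr (1 - p) * x powr p"
    by (metis mult.left_commute mult.right_neutral)
  then show ?thesis using assms by simp
qed (use assms in \<open>simp add: add_increasing2\<close>)

text \<open>
On \<open>B\<close> one has \<open>|y - w| \<le> \<rho>\<close>, so the kernel of the density is at least
\<open>\<rho>\<^bsup>-a\<^esup> |f(y) - f(w)|\<^sup>p\<close>; \<open>le_threshold_plus_powr\<close> then turns the \<open>p\<close>-th power into
a first power.
\<close>
lemma oscillation_le_frac_density:
  fixes f :: "'a::euclidean_space \<Rightarrow> real"
  assumes [measurable]: "f \<in> borel_measurable borel" "B \<in> sets borel"
    and B: "emeasure lborel B < \<infinity>" "B \<subseteq> N y" "\<And>w. w \<in> B \<Longrightarrow> dist y w \<le> \<rho>"
    and par: "0 < l" "1 \<le> p" "0 \<le> a" "0 < \<rho>"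
  shows "(\<integral>\<^sup>+w\<in>B. ennreal \<bar>f y - f w\<bar> \<partial>lborel) \<le>
    ennreal (l * measure lborel B) + ennreal (l powr (1 - p) * \<rho> powr a) * frac_density N a p f y"
proof -
  define K where "K w = \<bar>f y - f w\<bar> powr p / norm (y - w) powr a" for w
  have [measurable]: "K \<in> borel_measurable borel"
    unfolding K_def[abs_def] by measurable
  have pw: "\<bar>f y - f w\<bar> \<le> l + (l powr (1 - p) * \<rho> powr a) * K w" if "w \<in> B" for w
  proof (cases "w = y")
    case False
    have "norm (y - w) powr a \<le> \<rho> powr a"
      using B(3)[OF that] par by (intro powr_mono2) (auto simp: dist_norm)
    moreover have "0 < norm (y - w) powr a"
      using False by simp
    ultimately have "\<bar>f y - f w\<bar> powr p \<le> \<rho> powr a * K w"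
      unfolding K_def using mult_right_mono[of "norm (y - w) powr a" "\<rho> powr a" "\<bar>f y - f w\<bar> powr p"]
      by (simp add: field_simps)
    then have "l powr (1 - p) * \<bar>f y - f w\<bar> powr p \<le> l powr (1 - p) * (\<rho> powr a * K w)"
      by (intro mult_left_mono) auto
    with le_threshold_plus_powr[of "\<bar>f y - f w\<bar>" l p] par show ?thesis
      by (subst mult.assoc) linarith
  qed (use par in \<open>simp add: K_def\<close>)
  have "(\<integral>\<^sup>+w\<in>B. ennreal \<bar>f y - f w\<bar> \<partial>lborel) \<le>
      (\<integral>\<^sup>+w. ennreal l * indicator B w + ennreal (l powr (1 - p) * \<rho> powr a) * (ennreal (K w) * indicator B w) \<partial>lborel)"
  proof (intro nn_integral_mono)
    fix w
    have "ennreal \<bar>f y - f w\<bar> \<le> ennreal l + ennreal (l powr (1 - p) * \<rho> powr a) * ennreal (K w)" if "w \<in> B"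
      using pw[OF that] par
      by (subst ennreal_mult[symmetric]) (auto simp: K_def ennreal_plus[symmetric] simp del: ennreal_plus intro!: ennreal_leI)
    then show "ennreal \<bar>f y - f w\<bar> * indicator B w \<le>
        ennreal l * indicator B w + ennreal (l powr (1 - p) * \<rho> powr a) * (ennreal (K w) * indicator B w)"
      by (auto simp: indicator_def)
  qed
  also have "\<dots> = ennreal l * emeasure lborel B +
      ennreal (l powr (1 - p) * \<rho> powr a) * (\<integral>\<^sup>+w\<in>B. ennreal (K w) \<partial>lborel)"
    by (subst nn_integral_add, measurable) (simp_all add: nn_integral_cmult nn_integral_cmult_indicator)
  also have "(\<integral>\<^sup>+w\<in>B. ennreal (K w) \<partial>lborel) \<le> frac_density N a p f y"
    unfolding frac_density_def K_def
    using B(2) by (intro nn_integral_mono mult_left_mono) (auto simp: indicator_def)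
  also have "ennreal l * emeasure lborel B = ennreal (l * measure lborel B)"
    using B(1) par by (subst emeasure_eq_ennreal_measure) (auto simp: ennreal_mult)
  finally show ?thesis
    by (simp add: mult_left_mono)
qed

text \<open>
The first step of a chain, from the point itself to its first ball: a small density at \<open>y\<close> makes the
mean oscillation of \<open>f\<close> about the value \<open>f(y)\<close> small.
\<close>
lemma average_near_value:
  fixes f :: "'a::euclidean_space \<Rightarrow> real"
  assumes [measurable]: "f \<in> borel_measurable borel" "B \<in> sets borel"
    and f: "set_integrable lborel B f"
    and B: "emeasure lborel B < \<infinity>" "0 < measure lborel B" "B \<subseteq> N y"
      "\<And>w. w \<in> B \<Longrightarrow> dist y w \<le> \<rho>"
    and par: "0 < l" "1 \<le> p" "0 \<le> a" "0 < \<rho>"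
    and small: "frac_density N a p f y \<le> ennreal (l powr p * \<rho> powr (-a) * measure lborel B)"
  shows "\<bar>f y - average f B\<bar> \<le> 2 * l"
proof -
  let ?m = "measure lborel B"
  have "ennreal (\<bar>f y - average f B\<bar> * ?m) \<le> (\<integral>\<^sup>+w\<in>B. ennreal \<bar>f y - f w\<bar> \<partial>lborel)"
    using average_deviation_le[OF f] B by simp
  also have "\<dots> \<le> ennreal (l * ?m) + ennreal (l powr (1 - p) * \<rho> powr a) * frac_density N a p f y"
    using oscillation_le_frac_density[of f B N y \<rho> l p a] B par by simp
  also have "\<dots> \<le> ennreal (l * ?m) +
      ennreal (l powr (1 - p) * \<rho> powr a) * ennreal (l powr p * \<rho> powr (-a) * ?m)"
    using small by (intro add_left_mono mult_left_mono) auto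
  also have "\<dots> = ennreal (l * ?m + (l powr (1 - p) * \<rho> powr a) * (l powr p * \<rho> powr (-a) * ?m))"
    using par by (subst ennreal_mult[symmetric]) (auto simp: ennreal_plus[symmetric] simp del: ennreal_plus)
  also have "(l powr (1 - p) * \<rho> powr a) * (l powr p * \<rho> powr (-a) * ?m) =
      (l powr (1 - p) * l powr p) * (\<rho> powr a * \<rho> powr (-a)) * ?m"
    by (simp add: mult_ac)
  also have "\<dots> = l * ?m"
    using par by (simp add: powr_add[symmetric])
  finally have "\<bar>f y - average f B\<bar> * ?m \<le> (2 * l) * ?m"
    using par by (simp add: ennreal_le_iff)
  then show ?thesis
    using B by simp
qed

text \<open>
Integrate \<open>oscillation_le_frac_density\<close> for the set \<open>B'\<close> over the points \<open>y\<close> of \<open>B\<close>.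
\<close>
lemma averages_near_each_other:
  fixes f :: "'a::euclidean_space \<Rightarrow> real"
  assumes [measurable]: "f \<in> borel_measurable borel" "B \<in> sets borel" "B' \<in> sets borel"
    and N: "{(x, y). y \<in> N x} \<in> sets (borel \<Otimes>\<^sub>M borel)"
    and f: "set_integrable lborel B f" "set_integrable lborel B' f"
    and B: "emeasure lborel B < \<infinity>" "0 < measure lborel B"
    and B': "emeasure lborel B' < \<infinity>" "0 < measure lborel B'"
    and sub: "\<And>y. y \<in> B \<Longrightarrow> B' \<subseteq> N y" "\<And>y w. y \<in> B \<Longrightarrow> w \<in> B' \<Longrightarrow> dist y w \<le> \<rho>"
    and par: "0 < l" "1 \<le> p" "0 \<le> a" "0 < \<rho>"
    and small: "(\<integral>\<^sup>+y\<in>B. frac_density N a p f y \<partial>lborel) \<le>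
      ennreal (l powr p * \<rho> powr (-a) * measure lborel B * measure lborel B')"
  shows "\<bar>average f B - average f B'\<bar> \<le> 2 * l"
proof -
  let ?m = "measure lborel B" and ?m' = "measure lborel B'" and ?g = "frac_density N a p f"
  let ?A = "average f B'"
  have [measurable]: "?g \<in> borel_measurable borel"
    using N by (intro borel_measurable_frac_density) auto
  have pt: "ennreal ?m' * ennreal \<bar>?A - f y\<bar> \<le>
      ennreal (l * ?m') + ennreal (l powr (1 - p) * \<rho> powr a) * ?g y" if "y \<in> B" for y
  proof -
    have "ennreal ?m' * ennreal \<bar>?A - f y\<bar> = ennreal (\<bar>f y - ?A\<bar> * ?m')"
      by (simp add: ennreal_mult[symmetric] mult.commute abs_minus_commute)
    also have "\<dots> \<le> (\<integral>\<^sup>+w\<in>B'. ennreal \<bar>f y - f w\<bar> \<partial>lborel)"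
      using average_deviation_le[OF f(2)] B' by simp
    also have "\<dots> \<le> ennreal (l * ?m') + ennreal (l powr (1 - p) * \<rho> powr a) * ?g y"
      using oscillation_le_frac_density[of f B' N y \<rho> l p a] B' par sub that by simp
    finally show ?thesis .
  qed
  have "ennreal (\<bar>?A - average f B\<bar> * ?m * ?m') = ennreal ?m' * ennreal (\<bar>?A - average f B\<bar> * ?m)"
    by (simp add: ennreal_mult[symmetric] mult_ac)
  also have "\<dots> \<le> ennreal ?m' * (\<integral>\<^sup>+y\<in>B. ennreal \<bar>?A - f y\<bar> \<partial>lborel)"
    using average_deviation_le[OF f(1)] B by (intro mult_left_mono) auto
  also have "\<dots> = (\<integral>\<^sup>+y. ennreal ?m' * (ennreal \<bar>?A - f y\<bar> * indicator B y) \<partial>lborel)"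
    by (simp add: nn_integral_cmult)
  also have "\<dots> \<le> (\<integral>\<^sup>+y. ennreal (l * ?m') * indicator B y +
      ennreal (l powr (1 - p) * \<rho> powr a) * (?g y * indicator B y) \<partial>lborel)"
    using pt by (intro nn_integral_mono) (auto simp: indicator_def)
  also have "\<dots> = ennreal (l * ?m') * emeasure lborel B +
      ennreal (l powr (1 - p) * \<rho> powr a) * (\<integral>\<^sup>+y\<in>B. ?g y \<partial>lborel)"
    by (subst nn_integral_add, measurable) (simp_all add: nn_integral_cmult nn_integral_cmult_indicator)
  also have "\<dots> \<le> ennreal (l * ?m') * ennreal ?m + ennreal (l powr (1 - p) * \<rho> powr a) *
      ennreal (l powr p * \<rho> powr (-a) * ?m * ?m')"
    using small B by (intro add_mono mult_left_mono) (auto simp: emeasure_eq_ennreal_measure)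
  also have "\<dots> = ennreal (l * ?m' * ?m +
      (l powr (1 - p) * \<rho> powr a) * (l powr p * \<rho> powr (-a) * ?m * ?m'))"
    using par by (simp add: ennreal_mult[symmetric] ennreal_plus[symmetric] del: ennreal_plus)
  also have "(l powr (1 - p) * \<rho> powr a) * (l powr p * \<rho> powr (-a) * ?m * ?m') =
      (l powr (1 - p) * l powr p) * (\<rho> powr a * \<rho> powr (-a)) * (?m * ?m')"
    by (simp add: mult_ac)
  also have "\<dots> = l * (?m * ?m')"
    using par by (simp add: powr_add[symmetric])
  finally have "\<bar>?A - average f B\<bar> * (?m * ?m') \<le> (2 * l) * (?m * ?m')"
    using par by (simp add: ennreal_le_iff algebra_simps)
  then show ?thesis
    using B B' by (simp add: abs_minus_commute)
qed

section \<open>A Vitali covering estimate\<close>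

text \<open>
The weak-type bound for a maximal function restricted to radii at most \<open>R\<close>.  Disjoint balls
\<open>B(x, 2 \<rho>)\<close> are selected whose fivefold enlargements cover \<open>S\<close>; each enlargement has measure at most a
constant times the mass of its own ball.
\<close>
lemma vitali_density_bound:
  fixes G :: "'a::euclidean_space \<Rightarrow> ennreal"
  assumes [measurable]: "G \<in> borel_measurable borel" and \<alpha>: "0 < \<alpha>"
    and dense: "\<And>x. x \<in> S \<Longrightarrow> \<exists>\<rho>. 0 < \<rho> \<and> \<rho> \<le> R \<and>
      ennreal (\<alpha> * \<rho> ^ DIM('a)) \<le> (\<integral>\<^sup>+y\<in>ball x (2 * \<rho>). G y \<partial>lborel)"
  shows "\<exists>U. open U \<and> S \<subseteq> U \<and>
    emeasure lborel U \<le> ennreal (unit_ball_vol (DIM('a)) * 10 ^ DIM('a) / \<alpha>) * (\<integral>\<^sup>+y. G y \<partial>lborel)"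
proof -
  let ?M = "unit_ball_vol (DIM('a)) * 10 ^ DIM('a) / \<alpha>"
  obtain \<rho> where \<rho>: "\<And>x. x \<in> S \<Longrightarrow> 0 < \<rho> x" "\<And>x. x \<in> S \<Longrightarrow> \<rho> x \<le> R"
    "\<And>x. x \<in> S \<Longrightarrow> ennreal (\<alpha> * \<rho> x ^ DIM('a)) \<le> (\<integral>\<^sup>+y\<in>ball x (2 * \<rho> x). G y \<partial>lborel)"
    using dense by metis
  have "0 < 2 * \<rho> x \<and> 2 * \<rho> x \<le> 2 * R" if "x \<in> S" for x
    using \<rho>[OF that] by simp
  then obtain C where C: "countable C" "C \<subseteq> S"
    and disj: "pairwise (\<lambda>i j. disjnt (cball i (2 * \<rho> i)) (cball j (2 * \<rho> j))) C"
    and cov: "\<And>i. i \<in> S \<Longrightarrow> \<exists>j. j \<in> C \<and> \<not> disjnt (cball i (2 * \<rho> i)) (cball j (2 * \<rho> j)) \<and>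
      cball i (2 * \<rho> i) \<subseteq> ball j (5 * (2 * \<rho> j))"
    by (rule Vitali_covering_lemma_cballs_balls[where a="\<lambda>x. x"]) (blast intro: that)+
  \<comment> \<open>The selected balls \<open>H\<close> and their enlargements \<open>F\<close> as sequences, padded with empty sets.\<close>
  define F where "F k = (if k \<in> to_nat_on C ` C then ball (inv_into C (to_nat_on C) k) (10 * \<rho> (inv_into C (to_nat_on C) k)) else {})" for k
  define H where "H k = (if k \<in> to_nat_on C ` C then ball (inv_into C (to_nat_on C) k) (2 * \<rho> (inv_into C (to_nat_on C) k)) else {})" for k
  have inj: "inj_on (to_nat_on C) C" using C(1) by (rule inj_on_to_nat_on)
  have [measurable]: "F k \<in> sets borel" "H k \<in> sets borel" for k
    by (auto simp: F_def H_def)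
  have "disjoint_family H"
    unfolding disjoint_family_on_def
  proof (intro ballI impI)
    fix k l :: nat assume "k \<noteq> l"
    show "H k \<inter> H l = {}"
    proof (cases "k \<in> to_nat_on C ` C \<and> l \<in> to_nat_on C ` C")
      case True
      then obtain i j where ij: "i \<in> C" "j \<in> C" "k = to_nat_on C i" "l = to_nat_on C j" by auto
      with \<open>k \<noteq> l\<close> have "disjnt (cball i (2 * \<rho> i)) (cball j (2 * \<rho> j))"
        using disj by (auto simp: pairwise_def)
      moreover have "H k = ball i (2 * \<rho> i)" "H l = ball j (2 * \<rho> j)"
        using ij inj by (auto simp: H_def)
      ultimately show ?thesis
        using ball_subset_cball unfolding disjnt_def by blast
    qed (auto simp: H_def)
  qed
  have each: "emeasure lborel (F k) \<le> ennreal ?M * (\<integral>\<^sup>+y\<in>H k. G y \<partial>lborel)" for k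
  proof (cases "k \<in> to_nat_on C ` C")
    case True
    then obtain i where i: "i \<in> C" "k = to_nat_on C i" by auto
    then have FH: "F k = ball i (10 * \<rho> i)" "H k = ball i (2 * \<rho> i)"
      using inj by (auto simp: F_def H_def)
    have "i \<in> S" using i C by auto
    have "emeasure lborel (F k) = ennreal (unit_ball_vol (DIM('a)) * (10 * \<rho> i) ^ DIM('a))"
      using \<rho>(1)[OF \<open>i \<in> S\<close>] by (simp add: FH emeasure_ball)
    also have "\<dots> = ennreal ?M * ennreal (\<alpha> * \<rho> i ^ DIM('a))"
      using \<alpha> \<rho>(1)[OF \<open>i \<in> S\<close>] by (subst ennreal_mult[symmetric]) (auto simp: power_mult_distrib)
    also have "\<dots> \<le> ennreal ?M * (\<integral>\<^sup>+y\<in>H k. G y \<partial>lborel)"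
      unfolding FH by (intro mult_left_mono \<rho>(3) \<open>i \<in> S\<close>) auto
    finally show ?thesis .
  qed (simp add: F_def)
  show ?thesis
  proof (intro exI[of _ "\<Union>k. F k"] conjI)
    show "open (\<Union>k. F k)" by (auto simp: F_def)
    show "S \<subseteq> (\<Union>k. F k)"
    proof
      fix x assume x: "x \<in> S"
      then obtain j where j: "j \<in> C" "cball x (2 * \<rho> x) \<subseteq> ball j (5 * (2 * \<rho> j))"
        using cov by blast
      moreover have "x \<in> cball x (2 * \<rho> x)" using \<rho>(1)[OF x] by simp
      ultimately have "x \<in> ball j (5 * (2 * \<rho> j))" by blast
      then have "x \<in> F (to_nat_on C j)"
        using inj j by (auto simp: F_def)
      then show "x \<in> (\<Union>k. F k)" by blast
    qed
    have "emeasure lborel (\<Union>k. F k) \<le> (\<Sum>k. emeasure lborel (F k))"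
      by (intro emeasure_subadditive_countably) auto
    also have "\<dots> \<le> (\<Sum>k. ennreal ?M * (\<integral>\<^sup>+y\<in>H k. G y \<partial>lborel))"
      by (intro suminf_le each) auto
    also have "\<dots> = ennreal ?M * (\<Sum>k. \<integral>\<^sup>+y\<in>H k. G y \<partial>lborel)"
      by simp
    also have "(\<Sum>k. \<integral>\<^sup>+y\<in>H k. G y \<partial>lborel) = (\<integral>\<^sup>+y\<in>(\<Union>k. H k). G y \<partial>lborel)"
      using \<open>disjoint_family H\<close> by (intro nn_integral_disjoint_family[symmetric]) auto
    also have "\<dots> \<le> (\<integral>\<^sup>+y. G y \<partial>lborel)"
      by (intro nn_integral_mono) (auto simp: indicator_def)
    finally show "emeasure lborel (\<Union>k. F k) \<le> ennreal ?M * (\<integral>\<^sup>+y. G y \<partial>lborel)"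
      by (simp add: mult_left_mono)
  qed
qed

section \<open>Chains of balls and the weak-type estimate\<close>

text \<open>
The bound does not depend on the position \<open>m\<close> of the peak.  Here \<open>m\<close> is the number of steps that a chain
needs to reach the critical scale \<open>R\<close>, and it grows without bound near the boundary.
\<close>
lemma two_sided_geometric_sum_le:
  fixes x y :: real
  assumes x: "0 \<le> x" "x < 1" and y: "0 \<le> y" "y < 1"
  shows "(\<Sum>i<I. if i \<le> m then x ^ (m - i) else y ^ (i - m)) \<le> 1 / (1 - x) + 1 / (1 - y)"
proof -
  have geo: "sum ((^) q) A \<le> 1 / (1 - q)" if "0 \<le> q" "q < 1" "finite A" for q :: real and A
    using sum_le_suminf[of "\<lambda>i. q ^ i" A] that by (simp add: suminf_geometric summable_geometric)
  have "(\<Sum>i<I. if i \<le> m then x ^ (m - i) else y ^ (i - m)) =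
      (\<Sum>i\<in>{..<I} \<inter> {i. i \<le> m}. x ^ (m - i)) + (\<Sum>i\<in>{..<I} \<inter> - {i. i \<le> m}. y ^ (i - m))"
    by (rule sum.If_cases) simp
  also have "(\<Sum>i\<in>{..<I} \<inter> {i. i \<le> m}. x ^ (m - i)) = sum ((^) x) ((\<lambda>i. m - i) ` ({..<I} \<inter> {i. i \<le> m}))"
    by (subst sum.reindex) (auto simp: inj_on_def)
  also have "(\<Sum>i\<in>{..<I} \<inter> - {i. i \<le> m}. y ^ (i - m)) = sum ((^) y) ((\<lambda>i. i - m) ` ({..<I} \<inter> - {i. i \<le> m}))"
    by (subst sum.reindex) (auto simp: inj_on_def)
  also have "sum ((^) x) ((\<lambda>i. m - i) ` ({..<I} \<inter> {i. i \<le> m})) + sum ((^) y) ((\<lambda>i. i - m) ` ({..<I} \<inter> - {i. i \<le> m}))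
      \<le> 1 / (1 - x) + 1 / (1 - y)"
    using x y by (intro add_mono geo) auto
  finally show ?thesis .
qed

text \<open>
The interface between geometry and analysis: everything that the Sobolev inequality uses about \<open>D\<close> and \<open>N\<close>, apart
from measurability, is that chains of every length \<open>I\<close> and every small initial scale \<open>r\<close> start at each
of its points.
\<close>
definition ball_chain ::
    "('a::euclidean_space \<Rightarrow> 'a set) \<Rightarrow> 'a set \<Rightarrow> real \<Rightarrow> real \<Rightarrow> nat \<Rightarrow> 'a \<Rightarrow> (nat \<Rightarrow> 'a) \<Rightarrow> bool" where
  "ball_chain N D \<kappa> r I x z \<longleftrightarrow>
     (let \<rho> = (\<lambda>i. r * (1 + \<kappa>) ^ i); B = (\<lambda>i. ball (z i) (\<kappa> * \<rho> i)) in
       z 0 = x \<and> B 0 \<subseteq> N x \<and> (\<forall>i\<le>I. B i \<subseteq> D \<inter> ball x (2 * \<rho> i)) \<and>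
       (\<forall>i<I. \<forall>y\<in>B i. B (Suc i) \<subseteq> N y \<and> (\<forall>w\<in>B (Suc i). dist y w \<le> 4 * \<kappa> * \<rho> i)))"

text \<open>
Makes the last average of a long chain negligible, since the measure of its ball tends to infinity.
\<close>
lemma average_le_of_finite_support:
  fixes f :: "'a::euclidean_space \<Rightarrow> real"
  assumes [measurable]: "f \<in> borel_measurable borel"
    and f: "\<And>x. 0 \<le> f x" "\<And>x. f x \<le> t"
    and supp: "emeasure lborel {x. f x \<noteq> 0} < \<infinity>"
    and B: "B \<in> sets borel" "emeasure lborel B < \<infinity>"
  shows "set_integrable lborel B f"
    and "average f B \<le> t * measure lborel {x. f x \<noteq> 0} / measure lborel B"
proof -
  have [measurable]: "B \<in> sets borel" by (fact B)
  have t: "0 \<le> t" using f[of undefined] by linarith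
  have int: "integrable lborel f"
    using supp f by (intro integrableI_bounded_set[where A="{x. f x \<noteq> 0}" and B=t]) auto
  then show *: "set_integrable lborel B f"
    unfolding set_integrable_def by (intro integrable_mult_indicator) auto
  have "(LINT x:B|lborel. f x) \<le> (LINT x|lborel. indicator {x. f x \<noteq> 0} x *\<^sub>R t)"
    unfolding set_lebesgue_integral_def
  proof (intro integral_mono)
    show "integrable lborel (\<lambda>x. indicator {x. f x \<noteq> 0} x *\<^sub>R t)"
      using supp by simp
  qed (use * f t in \<open>auto simp: set_integrable_def indicator_def\<close>)
  also have "\<dots> = t * measure lborel {x. f x \<noteq> 0}"
    by simp
  finally show "average f B \<le> t * measure lborel {x. f x \<noteq> 0} / measure lborel B"
    unfolding average_def by (intro divide_right_mono) auto
qed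

text \<open>
The total of two geometric series: the scales \<open>\<rho> \<le> R\<close> contribute \<open>(\<rho> / R)\<^bsup>\<delta>\<^esup>\<close> and the
scales \<open>\<rho> > R\<close> contribute \<open>(\<rho> / R)\<^bsup>\<delta> - n / p\<^esup>\<close>.
\<close>
definition chain_sum_bound :: "real \<Rightarrow> real \<Rightarrow> real \<Rightarrow> real \<Rightarrow> real" where
  "chain_sum_bound n \<delta> p \<kappa> =
     1 / (1 - (1 + \<kappa>) powr - \<delta>) + 1 / (1 - (1 + \<kappa>) powr - (n / p - \<delta>))"

text \<open>
The threshold below which the densities along a chain cannot carry a function from \<open>t\<close> down to zero.  The
factor \<open>(4 \<kappa>)\<^bsup>-(n + \<delta> p)\<^esup>\<close> is a lower bound of the kernel on two consecutive balls of scale one,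
and the minimum is taken over the measure of one such ball and the product of two: the former serves the step
from the point \<open>x\<close> to its first ball, the latter the steps between balls.
\<close>
definition chain_const :: "real \<Rightarrow> real \<Rightarrow> real \<Rightarrow> real \<Rightarrow> real" where
  "chain_const n \<delta> p \<kappa> =
     (1 / (4 * (1 + chain_sum_bound n \<delta> p \<kappa>))) powr p * (4 * \<kappa>) powr - (n + \<delta> * p) *
     min (unit_ball_vol n * \<kappa> powr n) ((unit_ball_vol n * \<kappa> powr n)\<^sup>2)"

lemma powr_neg_lt_one: "1 < b \<Longrightarrow> 0 < e \<Longrightarrow> b powr - e < (1::real)"
  using powr_less_mono[of "- e" 0 b] by simp

lemma chain_sum_bound_pos:
  assumes "0 < \<delta>" "1 \<le> p" "\<delta> * p < n" "0 < \<kappa>"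
  shows "0 < chain_sum_bound n \<delta> p \<kappa>"
proof -
  have "0 < n / p - \<delta>" using assms by (simp add: field_simps)
  then show ?thesis
    unfolding chain_sum_bound_def using assms powr_neg_lt_one[of "1 + \<kappa>" \<delta>] powr_neg_lt_one[of "1 + \<kappa>" "n / p - \<delta>"]
    by (intro add_pos_pos divide_pos_pos) auto
qed

lemma chain_const_pos:
  assumes "0 < \<delta>" "1 \<le> p" "\<delta> * p < n" "0 < \<kappa>"
  shows "0 < chain_const n \<delta> p \<kappa>"
proof -
  have "0 < \<delta> * p" using assms by simp
  then have "0 < n" using assms(3) by linarith
  then have "0 < unit_ball_vol n * \<kappa> powr n" using assms by simp
  then show ?thesis
    unfolding chain_const_def using assms chain_sum_bound_pos[OF assms]
    by (intro mult_pos_pos) auto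
qed

text \<open>
Telescope from \<open>x\<close> along a chain.  With \<open>\<epsilon> = 1 / (4 (1 + S))\<close>, where \<open>S\<close> bounds the sum of the
weights below, the step at scale \<open>\<rho>\<close> costs at most \<open>2 \<epsilon> t\<close> times
\<open>(\<rho> / R)\<^bsup>\<delta>\<^esup>\<close> if \<open>\<rho> \<le> R\<close>, by the bounds on small balls, and \<open>2 \<epsilon> t\<close> times
\<open>(\<rho> / R)\<^bsup>\<delta> - n / p\<^esup>\<close> otherwise, by the bound on the total energy.  All
steps together cost at most \<open>t / 2\<close>, and the last average is less than \<open>t / 2\<close>.
\<close>
lemma value_less_of_small_densities:
  fixes f :: "'a::euclidean_space \<Rightarrow> real" and N :: "'a \<Rightarrow> 'a set"
  defines "n \<equiv> real DIM('a)"
  defines "g \<equiv> \<lambda>\<delta> p. frac_density N (n + \<delta> * p) p f"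
  assumes [measurable]: "f \<in> borel_measurable borel"
    and f: "\<And>x. 0 \<le> f x" "\<And>x. f x \<le> t" and t: "0 < t"
    and supp: "emeasure lborel {x. f x \<noteq> 0} < \<infinity>"
    and N: "{(x, y). y \<in> N x} \<in> sets (borel \<Otimes>\<^sub>M borel)"
    and par: "0 < \<delta>" "1 \<le> p" "\<delta> * p < n" "0 < \<kappa>" and R: "0 < R"
    and chains: "0 < r\<^sub>0" "\<And>r I. 0 < r \<Longrightarrow> r \<le> r\<^sub>0 \<Longrightarrow> \<exists>z. ball_chain N D \<kappa> r I x z"
    and A: "A = chain_const n \<delta> p \<kappa>"
    and at_point: "g \<delta> p x \<le> ennreal (A * t powr p * R powr - (\<delta> * p))"
    and small_scales: "\<And>\<rho>. 0 < \<rho> \<Longrightarrow> \<rho> \<le> R \<Longrightarrow>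
      (\<integral>\<^sup>+y\<in>ball x (2 * \<rho>). g \<delta> p y * indicator D y \<partial>lborel)
        \<le> ennreal (A * t powr p * R powr - (\<delta> * p) * \<rho> ^ DIM('a))"
    and total: "(\<integral>\<^sup>+y\<in>D. g \<delta> p y \<partial>lborel) \<le> ennreal (A * t powr p * R powr (n - \<delta> * p))"
  shows "f x < t"
proof -
  let ?a = "n + \<delta> * p"
  define \<beta> where "\<beta> = n / p - \<delta>"
  define S where "S = chain_sum_bound n \<delta> p \<kappa>"
  define \<epsilon> where "\<epsilon> = 1 / (4 * (1 + S))"
  define \<omega> where "\<omega> = unit_ball_vol n * \<kappa> powr n"
  define b where "b = (4 * \<kappa>) powr - ?a * min \<omega> (\<omega>\<^sup>2)"
  have A_eq: "A = \<epsilon> powr p * b"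
    unfolding A chain_const_def \<epsilon>_def S_def b_def \<omega>_def by simp
  have n: "0 < n" by (simp add: n_def)
  have \<beta>: "0 < \<beta>" "\<beta> * p = n - \<delta> * p" using par by (auto simp: \<beta>_def field_simps)
  have \<delta>p: "0 < \<delta> * p" using par by simp
  have "0 < S" unfolding S_def using par by (rule chain_sum_bound_pos)
  then have \<epsilon>: "0 < \<epsilon>" "\<epsilon> * (1 + S) = 1 / 4" by (auto simp: \<epsilon>_def)
  have \<omega>: "0 < \<omega>" using par n by (simp add: \<omega>_def)
  have b: "0 < b" using \<omega> par by (simp add: b_def)
  let ?\<theta> = "1 + \<kappa>"
  \<comment> \<open>The chain starts at a scale \<open>r \<le> r\<^sub>0\<close> from which it reaches the critical scale \<open>R\<close> after exactly \<open>m\<close> steps.\<close>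
  obtain m where m: "R / r\<^sub>0 < ?\<theta> ^ m"
    using real_arch_pow[of ?\<theta> "R / r\<^sub>0"] par by auto
  define r where "r = R / ?\<theta> ^ m"
  have r: "0 < r" "r \<le> r\<^sub>0"
    using R m chains(1) par by (auto simp: r_def field_simps)
  define \<rho> where "\<rho> i = r * ?\<theta> ^ i" for i
  have \<rho>: "0 < \<rho> i" "\<rho> i \<le> \<rho> (Suc i)" for i
    using r par by (auto simp: \<rho>_def)
  have \<rho>_R: "\<rho> i \<le> R" if "i \<le> m" for i
    using that R par by (auto simp: \<rho>_def r_def field_simps intro!: power_increasing)
  have ratio: "\<rho> i / R = ?\<theta> powr (real i - real m)" for i
    using R par by (simp add: \<rho>_def r_def powr_diff powr_realpow)
  \<comment> \<open>The length of the chain: the measure of the last ball exceeds four times that of the support of \<open>f\<close>.\<close>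
  obtain I where I: "4 * measure lborel {y. f y \<noteq> 0} / (\<omega> * r powr n) < (?\<theta> powr n) ^ I"
    using real_arch_pow[of "?\<theta> powr n"] par n by (metis gr_one_powr less_add_same_cancel1)
  obtain z where z: "ball_chain N D \<kappa> r I x z"
    using chains(2)[OF r] by blast
  define B where "B i = ball (z i) (\<kappa> * \<rho> i)" for i
  have z0: "z 0 = x" and B0: "B 0 \<subseteq> N x"
    and B_sub: "\<And>i. i \<le> I \<Longrightarrow> B i \<subseteq> D \<inter> ball x (2 * \<rho> i)"
    and B_N: "\<And>i y. i < I \<Longrightarrow> y \<in> B i \<Longrightarrow> B (Suc i) \<subseteq> N y"
    and B_dist: "\<And>i y w. i < I \<Longrightarrow> y \<in> B i \<Longrightarrow> w \<in> B (Suc i) \<Longrightarrow> dist y w \<le> 4 * \<kappa> * \<rho> i"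
    using z unfolding ball_chain_def Let_def \<rho>_def[symmetric] B_def[symmetric] by auto
  have [measurable]: "B i \<in> sets borel" for i by (simp add: B_def)
  have B_m: "measure lborel (B i) = \<omega> * \<rho> i powr n" and B_fin: "emeasure lborel (B i) < \<infinity>" for i
  proof -
    have "emeasure lborel (B i) = ennreal (unit_ball_vol n * (\<kappa> * \<rho> i) ^ DIM('a))"
      unfolding B_def n_def using \<rho>(1)[of i] par by (intro emeasure_ball) auto
    also have "(\<kappa> * \<rho> i) ^ DIM('a) = \<kappa> powr n * \<rho> i powr n"
      using par \<rho>(1)[of i] by (simp add: n_def powr_realpow power_mult_distrib)
    finally have *: "emeasure lborel (B i) = ennreal (\<omega> * \<rho> i powr n)"
      by (simp add: \<omega>_def mult_ac)
    then show "emeasure lborel (B i) < \<infinity>" by simp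
    show "measure lborel (B i) = \<omega> * \<rho> i powr n"
      using * \<omega> by (simp add: measure_def)
  qed
  have B_pos: "0 < measure lborel (B i)" for i
    using \<omega> \<rho>(1)[of i] by (simp add: B_m)
  have f_int: "set_integrable lborel (B i) f" for i
    using f supp B_fin by (intro average_le_of_finite_support(1)) auto
  \<comment> \<open>Half of the bound for the difference of the averages over the \<open>i\<close>-th and the next ball.\<close>
  define l where "l i = \<epsilon> * t * (if i \<le> m then (\<rho> i / R) powr \<delta> else (\<rho> i / R) powr - \<beta>)" for i
  have l_pos: "0 < l i" for i
    using \<epsilon> t \<rho>(1)[of i] R by (simp add: l_def)
  have l_powr: "l i powr p * \<rho> i powr (n - \<delta> * p) = \<epsilon> powr p * t powr p *
      (if i \<le> m then R powr - (\<delta> * p) * \<rho> i powr n else R powr (n - \<delta> * p))" for i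
  proof (cases "i \<le> m")
    case True
    have "l i powr p = \<epsilon> powr p * t powr p * (\<rho> i powr (\<delta> * p) / R powr (\<delta> * p))"
      using True \<epsilon> t \<rho>(1)[of i] R by (simp add: l_def powr_mult powr_powr powr_divide)
    moreover have "\<rho> i powr (\<delta> * p) * \<rho> i powr (n - \<delta> * p) = \<rho> i powr n"
      using \<rho>(1)[of i] by (simp add: powr_add[symmetric])
    ultimately show ?thesis
      using True by (simp add: powr_minus field_simps)
    next
    case False
    define e where "e = n - \<delta> * p"
    have "l i powr p = \<epsilon> powr p * t powr p * (\<rho> i powr - e / R powr - e)"
      using False \<epsilon> t \<rho>(1)[of i] R \<beta>(2) by (simp add: e_def l_def powr_mult powr_powr powr_divide)
    then show ?thesis
      unfolding e_def[symmetric] using False \<rho>(1)[of i] by (simp add: powr_minus field_simps)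
  qed
  have step: "\<bar>average f (B i) - average f (B (Suc i))\<bar> \<le> 2 * l i" if i: "i < I" for i
  proof (rule averages_near_each_other[where N=N and a="?a" and p=p and \<rho>="4 * \<kappa> * \<rho> i"])
    have "(\<integral>\<^sup>+y\<in>B i. g \<delta> p y \<partial>lborel) \<le> ennreal (b * (l i powr p * \<rho> i powr (n - \<delta> * p)))"
    proof (cases "i \<le> m")
      case True
      have "(\<integral>\<^sup>+y\<in>B i. g \<delta> p y \<partial>lborel) \<le> (\<integral>\<^sup>+y\<in>ball x (2 * \<rho> i). g \<delta> p y * indicator D y \<partial>lborel)"
        using B_sub[of i] i by (intro nn_integral_mono) (auto simp: indicator_def)
      also have "\<dots> \<le> ennreal (A * t powr p * R powr - (\<delta> * p) * \<rho> i ^ DIM('a))"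
        using True by (intro small_scales \<rho> \<rho>_R)
      also have "\<rho> i ^ DIM('a) = \<rho> i powr n"
        using \<rho>(1)[of i] by (simp add: n_def powr_realpow)
      finally show ?thesis
        unfolding l_powr using True by (simp add: A_eq mult_ac)
    next
      case False
      have "(\<integral>\<^sup>+y\<in>B i. g \<delta> p y \<partial>lborel) \<le> (\<integral>\<^sup>+y\<in>D. g \<delta> p y \<partial>lborel)"
        using B_sub[of i] i by (intro nn_integral_mono) (auto simp: indicator_def)
      also note total
      finally show ?thesis
        unfolding l_powr using False by (simp add: A_eq mult_ac)
    qed
    also have "b * (l i powr p * \<rho> i powr (n - \<delta> * p)) \<le>
        l i powr p * (4 * \<kappa> * \<rho> i) powr - ?a * measure lborel (B i) * measure lborel (B (Suc i))"
    proof -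
      have "\<rho> i powr (n - \<delta> * p) = \<rho> i powr - ?a * \<rho> i powr n * \<rho> i powr n"
        using \<rho>(1)[of i] by (simp add: powr_add[symmetric])
      also have "\<dots> \<le> \<rho> i powr - ?a * \<rho> i powr n * \<rho> (Suc i) powr n"
        using \<rho>[of i] n by (intro mult_left_mono powr_mono2) auto
      finally have 1: "\<rho> i powr (n - \<delta> * p) \<le> \<rho> i powr - ?a * \<rho> i powr n * \<rho> (Suc i) powr n" .
      have "b \<le> (4 * \<kappa>) powr - ?a * \<omega>\<^sup>2"
        unfolding b_def by (intro mult_left_mono) auto
      with 1 have "(b * \<rho> i powr (n - \<delta> * p)) * l i powr p \<le>
          (((4 * \<kappa>) powr - ?a * \<omega>\<^sup>2) * (\<rho> i powr - ?a * \<rho> i powr n * \<rho> (Suc i) powr n)) * l i powr p"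
        using b by (intro mult_right_mono mult_mono) auto
      moreover have "(4 * \<kappa> * \<rho> i) powr - ?a = (4 * \<kappa>) powr - ?a * \<rho> i powr - ?a"
        using par \<rho>(1)[of i] by (subst powr_mult[symmetric]) auto
      ultimately show ?thesis
        unfolding B_m by (simp add: power2_eq_square mult_ac)
    qed
    finally show "(\<integral>\<^sup>+y\<in>B i. frac_density N ?a p f y \<partial>lborel) \<le> ennreal (l i powr p *
        (4 * \<kappa> * \<rho> i) powr - ?a * measure lborel (B i) * measure lborel (B (Suc i)))"
      by (simp add: g_def ennreal_leI)
  qed (use i B_N B_dist B_fin B_pos f_int N l_pos par \<delta>p n \<rho>(1)[of i] in \<open>auto\<close>)
  have start: "\<bar>f x - average f (B 0)\<bar> \<le> 2 * l 0"
  proof (rule average_near_value[where N=N and a="?a" and p=p and \<rho>="4 * \<kappa> * \<rho> 0"])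
    have *: "\<rho> 0 powr (n - \<delta> * p) = \<rho> 0 powr - ?a * \<rho> 0 powr n * \<rho> 0 powr n"
      using \<rho>(1)[of 0] by (simp add: powr_add[symmetric])
    have "(A * t powr p * R powr - (\<delta> * p)) * \<rho> 0 powr n = b * (l 0 powr p * \<rho> 0 powr (n - \<delta> * p))"
      unfolding l_powr by (simp add: A_eq mult_ac)
    also have "\<dots> \<le> ((4 * \<kappa>) powr - ?a * \<omega>) * (l 0 powr p * \<rho> 0 powr (n - \<delta> * p))"
      unfolding b_def by (intro mult_right_mono mult_left_mono) auto
    also have "\<dots> = (l 0 powr p * ((4 * \<kappa>) powr - ?a * \<rho> 0 powr - ?a) * (\<omega> * \<rho> 0 powr n)) * \<rho> 0 powr n"
      unfolding * by (simp add: mult_ac)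
    finally have "(A * t powr p * R powr - (\<delta> * p)) * \<rho> 0 powr n \<le>
        (l 0 powr p * ((4 * \<kappa>) powr - ?a * \<rho> 0 powr - ?a) * (\<omega> * \<rho> 0 powr n)) * \<rho> 0 powr n" .
    then have "A * t powr p * R powr - (\<delta> * p) \<le>
        l 0 powr p * ((4 * \<kappa>) powr - ?a * \<rho> 0 powr - ?a) * (\<omega> * \<rho> 0 powr n)"
      using \<rho>(1)[of 0] by (simp add: mult_le_cancel_right)
    moreover have "(4 * \<kappa> * \<rho> 0) powr - ?a = (4 * \<kappa>) powr - ?a * \<rho> 0 powr - ?a"
      using par \<rho>(1)[of 0] by (subst powr_mult[symmetric]) auto
    ultimately have "A * t powr p * R powr - (\<delta> * p) \<le>
        l 0 powr p * (4 * \<kappa> * \<rho> 0) powr - ?a * measure lborel (B 0)"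
      unfolding B_m by simp
    then show "frac_density N ?a p f x \<le>
        ennreal (l 0 powr p * (4 * \<kappa> * \<rho> 0) powr - ?a * measure lborel (B 0))"
      using at_point unfolding g_def by (meson ennreal_leI order_trans)
    fix w assume "w \<in> B 0"
    then have "dist x w < \<kappa> * \<rho> 0" by (simp add: B_def z0)
    also have "\<dots> \<le> 4 * \<kappa> * \<rho> 0" using par \<rho>(1)[of 0] by simp
    finally show "dist x w \<le> 4 * \<kappa> * \<rho> 0" by simp
  qed (use B0 B_fin B_pos f_int l_pos par \<delta>p n \<rho>(1)[of 0] in auto)
  have l_sum: "(\<Sum>i<I. l i) \<le> \<epsilon> * t * S"
  proof -
    have "l i = \<epsilon> * t * (if i \<le> m then (?\<theta> powr - \<delta>) ^ (m - i) else (?\<theta> powr - \<beta>) ^ (i - m))" for i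
      unfolding l_def ratio using par
      by (auto simp: powr_powr powr_realpow[symmetric] of_nat_diff algebra_simps)
    then have "(\<Sum>i<I. l i) = \<epsilon> * t *
        (\<Sum>i<I. if i \<le> m then (?\<theta> powr - \<delta>) ^ (m - i) else (?\<theta> powr - \<beta>) ^ (i - m))"
      by (simp add: sum_distrib_left)
    also have "\<dots> \<le> \<epsilon> * t * S"
      unfolding S_def chain_sum_bound_def \<beta>_def[symmetric] using \<epsilon> t par \<beta>
      by (intro mult_left_mono two_sided_geometric_sum_le powr_neg_lt_one) auto
    finally show ?thesis .
  qed
  have l_0: "l 0 \<le> \<epsilon> * t"
  proof -
    have "(\<rho> 0 / R) powr \<delta> \<le> 1"
      using \<rho>_R[of 0] \<rho>(1)[of 0] R par by (intro powr_le1) auto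
    then have "(\<epsilon> * t) * (\<rho> 0 / R) powr \<delta> \<le> (\<epsilon> * t) * 1"
      using \<epsilon> t by (intro mult_left_mono) auto
    then show ?thesis by (simp add: l_def)
  qed
  have "average f (B 0) - average f (B I) = (\<Sum>i<I. average f (B i) - average f (B (Suc i)))"
    using sum_lessThan_telescope'[of "\<lambda>i. average f (B i)" I] by simp
  also have "\<dots> \<le> (\<Sum>i<I. 2 * l i)"
  proof (intro sum_mono)
    fix i assume "i \<in> {..<I}"
    then show "average f (B i) - average f (B (Suc i)) \<le> 2 * l i"
      using step[of i] by simp
  qed
  also have "\<dots> \<le> 2 * (\<epsilon> * t * S)"
    using l_sum by (simp add: sum_distrib_left[symmetric])
  finally have "f x \<le> 2 * (t * (\<epsilon> * (1 + S))) + average f (B I)"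
    using start l_0 by (simp add: algebra_simps)
  moreover have "average f (B I) < t / 2"
  proof -
    have "4 * measure lborel {y. f y \<noteq> 0} < (?\<theta> powr n) ^ I * (\<omega> * r powr n)"
      using I \<omega> r by (simp add: pos_divide_less_eq)
    also have "\<dots> = measure lborel (B I)"
      unfolding B_m \<rho>_def using r par by (simp add: powr_mult powr_power powr_powr powr_realpow[symmetric] mult_ac)
    finally have "measure lborel {y. f y \<noteq> 0} / measure lborel (B I) < 1 / 4"
      using B_pos[of I] by (simp add: pos_divide_less_eq)
    then have "t * (measure lborel {y. f y \<noteq> 0} / measure lborel (B I)) < t * (1 / 4)"
      using t by (intro mult_strict_left_mono)
    then have "t * measure lborel {y. f y \<noteq> 0} / measure lborel (B I) < t / 4"
      by simp
    moreover have "average f (B I) \<le> t * measure lborel {y. f y \<noteq> 0} / measure lborel (B I)"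
      using f supp B_fin by (intro average_le_of_finite_support(2)) auto
    ultimately show ?thesis using t by linarith
  qed
  ultimately show "f x < t"
    using \<epsilon>(2) t by simp
qed

text \<open>
The scale \<open>R\<close> is chosen from an upper bound \<open>E\<close> of the energy, whereas the right-hand side stays linear in
the energy itself.  When the estimate is applied to all dyadic bands of a function with the same \<open>E\<close>, the
sum over the bands is then controlled by superadditivity of the energy.
\<close>
lemma weak_type_estimate:
  fixes f :: "'a::euclidean_space \<Rightarrow> real" and N :: "'a \<Rightarrow> 'a set"
  defines "n \<equiv> real DIM('a)"
  assumes [measurable]: "f \<in> borel_measurable borel"
    and f: "\<And>x. 0 \<le> f x" "\<And>x. f x \<le> t" and t: "0 < t"
    and supp: "emeasure lborel {x. f x \<noteq> 0} < \<infinity>"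
    and N: "{(x, y). y \<in> N x} \<in> sets (borel \<Otimes>\<^sub>M borel)"
    and D [measurable]: "D \<in> sets borel"
    and par: "0 < \<delta>" "1 \<le> p" "\<delta> * p < n" "0 < \<kappa>"
    and chains: "\<And>x. x \<in> D \<Longrightarrow> \<exists>r\<^sub>0>0. \<forall>r I. 0 < r \<longrightarrow> r \<le> r\<^sub>0 \<longrightarrow> (\<exists>z. ball_chain N D \<kappa> r I x z)"
    and A: "A = chain_const n \<delta> p \<kappa>"
    and E: "0 < E" "(\<integral>\<^sup>+y\<in>D. frac_density N (n + \<delta> * p) p f y \<partial>lborel) \<le> ennreal E"
    and \<sigma>: "\<sigma> = \<delta> * p / (n - \<delta> * p)"
  shows "emeasure lborel {x \<in> D. f x = t} \<le>
    ennreal ((1 + unit_ball_vol n * 10 powr n) * A powr - (1 + \<sigma>) * E powr \<sigma> * t powr - (p * (1 + \<sigma>))) *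
      (\<integral>\<^sup>+y\<in>D. frac_density N (n + \<delta> * p) p f y \<partial>lborel)"
proof -
  let ?g = "frac_density N (n + \<delta> * p) p f"
  let ?I = "\<integral>\<^sup>+y\<in>D. ?g y \<partial>lborel"
  have [measurable]: "?g \<in> borel_measurable borel"
    using N by (intro borel_measurable_frac_density) auto
  have A0: "0 < A" unfolding A using par by (rule chain_const_pos)
  define R where "R = (E / (A * t powr p)) powr (1 / (n - \<delta> * p))"
  define \<alpha> where "\<alpha> = A * t powr p * R powr - (\<delta> * p)"
  have R: "0 < R" using A0 E t by (simp add: R_def)
  have \<alpha>: "0 < \<alpha>" using A0 t R by (simp add: \<alpha>_def)
  have R_total: "A * t powr p * R powr (n - \<delta> * p) = E"
    using A0 E t par by (simp add: R_def powr_powr)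
  have "\<exists>U. open U \<and> {x \<in> D. \<exists>\<rho>. 0 < \<rho> \<and> \<rho> \<le> R \<and>
      ennreal (\<alpha> * \<rho> ^ DIM('a)) \<le> (\<integral>\<^sup>+y\<in>ball x (2 * \<rho>). ?g y * indicator D y \<partial>lborel)} \<subseteq> U \<and>
    emeasure lborel U \<le> ennreal (unit_ball_vol (DIM('a)) * 10 ^ DIM('a) / \<alpha>) * ?I"
    using \<alpha> by (intro vitali_density_bound) auto
  then obtain U where U: "open U" "{x \<in> D. \<exists>\<rho>. 0 < \<rho> \<and> \<rho> \<le> R \<and>
      ennreal (\<alpha> * \<rho> ^ DIM('a)) \<le> (\<integral>\<^sup>+y\<in>ball x (2 * \<rho>). ?g y * indicator D y \<partial>lborel)} \<subseteq> U"
    "emeasure lborel U \<le> ennreal (unit_ball_vol n * 10 powr n / \<alpha>) * ?I"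
    by (auto simp: n_def powr_realpow)
  define V where "V = {x \<in> D. 1 \<le> ennreal (1 / \<alpha>) * ?g x}"
  have [measurable]: "V \<in> sets borel" "U \<in> sets borel"
    using U(1) by (auto simp: V_def)
  have "{x \<in> D. f x = t} \<subseteq> V \<union> U"
  proof (rule ccontr)
    assume "\<not> {x \<in> D. f x = t} \<subseteq> V \<union> U"
    then obtain x where x: "x \<in> D" "f x = t" "x \<notin> V" "x \<notin> U" by auto
    obtain r\<^sub>0 where r0: "0 < r\<^sub>0" "\<And>r I. 0 < r \<Longrightarrow> r \<le> r\<^sub>0 \<Longrightarrow> \<exists>z. ball_chain N D \<kappa> r I x z"
      using chains[OF x(1)] by blast
    have "f x < t"
    proof (rule value_less_of_small_densities[where N=N and D=D and A=A and R=R and \<delta>=\<delta> and p=p and \<kappa>=\<kappa> and r\<^sub>0=r\<^sub>0])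
      have "ennreal (1 / \<alpha>) * ?g x \<le> 1"
        using x by (auto simp: V_def not_le intro: less_imp_le)
      then have "ennreal \<alpha> * (ennreal (1 / \<alpha>) * ?g x) \<le> ennreal \<alpha> * 1"
        by (intro mult_left_mono) auto
      then have "?g x \<le> ennreal \<alpha>"
        using \<alpha> by (simp add: mult.assoc[symmetric] ennreal_mult[symmetric])
      then show "frac_density N (real DIM('a) + \<delta> * p) p f x \<le> ennreal (A * t powr p * R powr - (\<delta> * p))"
        by (simp add: \<alpha>_def n_def)
    next
      fix \<rho> assume "0 < \<rho>" "\<rho> \<le> R"
      then have "\<not> ennreal (\<alpha> * \<rho> ^ DIM('a)) \<le> (\<integral>\<^sup>+y\<in>ball x (2 * \<rho>). ?g y * indicator D y \<partial>lborel)"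
        using U(2) x by blast
      then show "(\<integral>\<^sup>+y\<in>ball x (2 * \<rho>). frac_density N (real DIM('a) + \<delta> * p) p f y * indicator D y \<partial>lborel)
          \<le> ennreal (A * t powr p * R powr - (\<delta> * p) * \<rho> ^ DIM('a))"
        by (simp add: \<alpha>_def n_def)
    next
      show "(\<integral>\<^sup>+y\<in>D. frac_density N (real DIM('a) + \<delta> * p) p f y \<partial>lborel)
          \<le> ennreal (A * t powr p * R powr (real DIM('a) - \<delta> * p))"
        using E(2) R_total by (simp add: n_def)
    qed (use assms r0 R in \<open>auto simp: n_def\<close>)
    with x show False by simp
  qed
  then have "emeasure lborel {x \<in> D. f x = t} \<le> emeasure lborel (V \<union> U)"
    by (intro emeasure_mono) auto
  also have "\<dots> \<le> emeasure lborel V + emeasure lborel U"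
    by (intro emeasure_subadditive) auto
  also have "\<dots> \<le> ennreal (1 / \<alpha>) * ?I + ennreal (unit_ball_vol n * 10 powr n / \<alpha>) * ?I"
    unfolding V_def by (intro add_mono U(3) nn_integral_Markov_inequality) auto
  also have "\<dots> = ennreal (1 / \<alpha> + unit_ball_vol n * 10 powr n / \<alpha>) * ?I"
    using \<alpha> by (subst ennreal_plus) (auto simp: distrib_right n_def)
  also have "1 / \<alpha> + unit_ball_vol n * 10 powr n / \<alpha> =
      (1 + unit_ball_vol n * 10 powr n) * (1 / \<alpha>)"
    by (simp add: add_divide_distrib)
  also have "1 / \<alpha> = A powr - (1 + \<sigma>) * E powr \<sigma> * t powr - (p * (1 + \<sigma>))"
  proof -
    have "R powr (\<delta> * p) = (E / (A * t powr p)) powr \<sigma>"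
      unfolding R_def \<sigma> by (simp add: powr_powr)
    also have "\<dots> = E powr \<sigma> / (A powr \<sigma> * t powr (p * \<sigma>))"
      using A0 E t by (simp add: powr_divide powr_mult powr_powr)
    finally have "1 / \<alpha> = (E powr \<sigma> / (A powr \<sigma> * t powr (p * \<sigma>))) / (A * t powr p)"
      unfolding \<alpha>_def using R by (simp add: powr_minus field_simps)
    also have "\<dots> = E powr \<sigma> / (A powr (1 + \<sigma>) * t powr (p * (1 + \<sigma>)))"
      using A0 by (simp add: powr_add distrib_left mult_ac)
    finally show ?thesis
      by (simp only: powr_minus) (simp add: field_simps)
  qed
  finally show ?thesis by (simp add: mult.assoc)
qed

section \<open>From weak type to strong type by truncation\<close>

text \<open>
For \<open>s \<ge> 0\<close>, the length of the part of the interval from \<open>0\<close> to \<open>s\<close> that lies between \<open>2\<^sup>k\<close> and \<open>2\<^bsup>k + 1\<^esup>\<close>.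
\<close>
definition band_truncation :: "int \<Rightarrow> real \<Rightarrow> real" where
  "band_truncation k s = min (max (s - 2 powr k) 0) (2 powr k)"

lemma borel_measurable_band_truncation [measurable]: "band_truncation k \<in> borel_measurable borel"
  unfolding band_truncation_def[abs_def] by measurable

lemma band_truncation_bounds: "0 \<le> band_truncation k s" "band_truncation k s \<le> 2 powr k"
  by (auto simp: band_truncation_def)

lemma band_truncation_zero [simp]: "band_truncation k 0 = 0"
  by (simp add: band_truncation_def)

lemma band_truncation_mono: "s \<le> s' \<Longrightarrow> band_truncation k s \<le> band_truncation k s'"
  by (auto simp: band_truncation_def)

lemma sum_band_truncation:
  "(\<Sum>i<j. band_truncation (m + int i) s) = min (max (s - 2 powr m) 0) (2 powr (m + int j) - 2 powr m)"
proof (induction j)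
  case (Suc j)
  have "2 powr (m + int (Suc j)) = 2 * 2 powr (m + int j)"
    by (simp add: powr_add)
  moreover have "2 powr m \<le> 2 powr (m + int j)"
    by simp
  moreover have "min (max (s - a) 0) (b - a) + min (max (s - b) 0) b = min (max (s - a) 0) (2 * b - a)"
    if "a \<le> b" "0 < b" for a b :: real
    using that by (auto simp: min_def max_def)
  ultimately show ?case
    using Suc by (simp add: band_truncation_def)
qed simp

text \<open>
The bands from \<open>m\<close> to \<open>m + j - 1\<close> add up to a truncation of \<open>s - 2\<^sup>m\<close>, which is 1-Lipschitz
in \<open>s\<close>; every finite set of bands is contained in such a range.
\<close>
lemma sum_band_truncation_diff_le:
  assumes "finite K"
  shows "(\<Sum>k\<in>K. \<bar>band_truncation k s - band_truncation k s'\<bar>) \<le> \<bar>s - s'\<bar>"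
proof -
  have *: "(\<Sum>k\<in>K. \<bar>band_truncation k s - band_truncation k s'\<bar>) \<le> s' - s" if "s \<le> s'" for s s'
  proof -
    obtain B where B: "\<And>k. k \<in> K \<Longrightarrow> \<bar>k\<bar> \<le> B"
      using bdd_above_finite[of "abs ` K"] assms by (auto simp: bdd_above_def)
    define m where "m = - \<bar>B\<bar>"
    define j where "j = nat (2 * \<bar>B\<bar> + 1)"
    have "K \<subseteq> (\<lambda>i. m + int i) ` {..<j}"
    proof
      fix k assume "k \<in> K"
      then have "k = m + int (nat (k - m))" "nat (k - m) < j"
        using B[of k] by (auto simp: m_def j_def)
      then show "k \<in> (\<lambda>i. m + int i) ` {..<j}" by blast
    qed
    then have "(\<Sum>k\<in>K. \<bar>band_truncation k s - band_truncation k s'\<bar>) \<le>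
        (\<Sum>k\<in>(\<lambda>i. m + int i) ` {..<j}. \<bar>band_truncation k s - band_truncation k s'\<bar>)"
      by (intro sum_mono2) auto
    also have "\<dots> = (\<Sum>i<j. band_truncation (m + int i) s' - band_truncation (m + int i) s)"
      using band_truncation_mono[OF that] by (subst sum.reindex) (simp_all add: inj_on_def abs_of_nonpos)
    also have "\<dots> \<le> s' - s"
      unfolding sum_subtractf sum_band_truncation using that by simp
    finally show ?thesis .
  qed
  show ?thesis
    using *[of s s'] *[of s' s] by (cases "s \<le> s'") (auto simp: abs_minus_commute)
qed

lemma sum_powr_le_powr_sum:
  fixes a :: "'b \<Rightarrow> real"
  assumes "\<And>k. k \<in> K \<Longrightarrow> 0 \<le> a k" "finite K" "1 \<le> p"
  shows "(\<Sum>k\<in>K. a k powr p) \<le> (\<Sum>k\<in>K. a k) powr p"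
proof -
  have "(\<Sum>k\<in>K. a k powr p) = (\<Sum>k\<in>K. a k * a k powr (p - 1))"
    using assms by (intro sum.cong) (auto simp: powr_mult_base)
  also have "\<dots> \<le> (\<Sum>k\<in>K. a k * (\<Sum>k\<in>K. a k) powr (p - 1))"
    using assms by (intro sum_mono mult_left_mono powr_mono2 member_le_sum) auto
  also have "\<dots> = (\<Sum>k\<in>K. a k) powr p"
    using assms by (simp add: sum_distrib_right[symmetric] powr_mult_base sum_nonneg)
  finally show ?thesis .
qed

text \<open>
The kernel is superadditive over the bands, because \<open>p \<ge> 1\<close> and the increments of the bands add up to at most the
increment of \<open>|f|\<close>.  The bijection \<open>int_decode\<close> from the naturals to the integers turns the sum over all
bands into an ordinary series.
\<close>
lemma suminf_frac_density_band_truncation_le: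
  fixes f :: "'a::euclidean_space \<Rightarrow> real"
  assumes [measurable]: "f \<in> borel_measurable borel"
    and N: "{(x, y). y \<in> N x} \<in> sets (borel \<Otimes>\<^sub>M borel)" and p: "1 \<le> p"
  shows "(\<Sum>i. frac_density N a p (\<lambda>x. band_truncation (int_decode i) \<bar>f x\<bar>) x) \<le> frac_density N a p f x"
proof -
  have [measurable]: "Measurable.pred (borel \<Otimes>\<^sub>M borel) (\<lambda>z. snd z \<in> N (fst z))"
    using N by (simp add: pred_def case_prod_beta' space_pair_measure)
  have "(\<lambda>y. snd (x, y) \<in> N (fst (x, y))) \<in> measurable borel (count_space UNIV)"
    by measurable
  then have [measurable]: "N x \<in> sets borel"
    by (simp add: pred_def)
  let ?T = "\<lambda>i x. band_truncation (int_decode i) \<bar>f x\<bar>"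
  have pw: "(\<Sum>i. ennreal (\<bar>?T i x - ?T i y\<bar> powr p / norm (x - y) powr a) * indicator (N x) y) \<le>
      ennreal (\<bar>f x - f y\<bar> powr p / norm (x - y) powr a) * indicator (N x) y" for y
  proof (intro suminf_le_const summableI)
    fix j
    have "(\<Sum>i<j. \<bar>?T i x - ?T i y\<bar>) = (\<Sum>k\<in>int_decode ` {..<j}. \<bar>band_truncation k \<bar>f x\<bar> - band_truncation k \<bar>f y\<bar>\<bar>)"
      by (subst sum.reindex) (auto simp: inj_int_decode)
    also have "\<dots> \<le> \<bar>\<bar>f x\<bar> - \<bar>f y\<bar>\<bar>"
      by (intro sum_band_truncation_diff_le) auto
    also have "\<dots> \<le> \<bar>f x - f y\<bar>" by simp
    finally have "(\<Sum>i<j. \<bar>?T i x - ?T i y\<bar>) powr p \<le> \<bar>f x - f y\<bar> powr p"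
      using p by (intro powr_mono2) (auto intro: sum_nonneg)
    moreover have "(\<Sum>i<j. \<bar>?T i x - ?T i y\<bar> powr p) \<le> (\<Sum>i<j. \<bar>?T i x - ?T i y\<bar>) powr p"
      using p by (intro sum_powr_le_powr_sum) auto
    ultimately have "(\<Sum>i<j. \<bar>?T i x - ?T i y\<bar> powr p / norm (x - y) powr a) \<le> \<bar>f x - f y\<bar> powr p / norm (x - y) powr a"
      unfolding sum_divide_distrib[symmetric] by (intro divide_right_mono) auto
    then show "(\<Sum>i<j. ennreal (\<bar>?T i x - ?T i y\<bar> powr p / norm (x - y) powr a) * indicator (N x) y) \<le>
        ennreal (\<bar>f x - f y\<bar> powr p / norm (x - y) powr a) * indicator (N x) y"
      by (auto simp: indicator_def sum_ennreal intro: ennreal_leI)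
  qed
  have "(\<Sum>i. frac_density N a p (?T i) x) =
      (\<integral>\<^sup>+y. (\<Sum>i. ennreal (\<bar>?T i x - ?T i y\<bar> powr p / norm (x - y) powr a) * indicator (N x) y) \<partial>lborel)"
    unfolding frac_density_def by (intro nn_integral_suminf[symmetric]) measurable
  also have "\<dots> \<le> frac_density N a p f x"
    unfolding frac_density_def by (intro nn_integral_mono pw)
  finally show ?thesis .
qed

lemma term_le_suminf: "f i \<le> suminf f" for f :: "nat \<Rightarrow> ennreal"
  using sum_le_suminf[of f "{i}"] by (simp add: summableI)

lemma exists_dyadic_band:
  assumes "0 < s"
  obtains k :: int where "2 powr (k + 1) \<le> s" "s \<le> 2 powr (k + 2)"
proof
  define k where "k = \<lfloor>log 2 s\<rfloor> - 1"
  have "real_of_int (k + 1) \<le> log 2 s" "log 2 s \<le> real_of_int (k + 2)"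
    by (auto simp: k_def) linarith
  then show "2 powr (k + 1) \<le> s" "s \<le> 2 powr (k + 2)"
    using assms by (simp_all add: le_log_iff log_le_iff)
qed

text \<open>
Where \<open>2\<^bsup>k + 1\<^esup> \<le> |f| \<le> 2\<^bsup>k + 2\<^esup>\<close>, the \<open>k\<close>-th band has its maximal value \<open>2\<^sup>k\<close>, so
\<open>\<integral> |f|\<^sup>q\<close> is at most the sum over \<open>k\<close> of \<open>2\<^bsup>(k + 2) q\<^esup>\<close> times the measure of the set where
the band is maximal.  The weak-type estimate cancels the factor \<open>2\<^bsup>k q\<^esup>\<close>.
\<close>
theorem sobolev_inequality_of_ball_chains:
  fixes f :: "'a::euclidean_space \<Rightarrow> real" and N :: "'a \<Rightarrow> 'a set"
  defines "n \<equiv> real DIM('a)"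
  assumes [measurable]: "f \<in> borel_measurable borel"
    and supp: "emeasure lborel {x. f x \<noteq> 0} < \<infinity>"
    and N: "{(x, y). y \<in> N x} \<in> sets (borel \<Otimes>\<^sub>M borel)"
    and D [measurable]: "D \<in> sets borel"
    and par: "0 < \<delta>" "1 \<le> p" "\<delta> * p < n" "0 < \<kappa>"
    and chains: "\<And>x. x \<in> D \<Longrightarrow> \<exists>r\<^sub>0>0. \<forall>r I. 0 < r \<longrightarrow> r \<le> r\<^sub>0 \<longrightarrow> (\<exists>z. ball_chain N D \<kappa> r I x z)"
    and E: "0 \<le> E" "(\<integral>\<^sup>+y\<in>D. frac_density N (n + \<delta> * p) p f y \<partial>lborel) = ennreal E"
    and q: "q = n * p / (n - \<delta> * p)"
    and C: "C = 4 powr q * (1 + unit_ball_vol n * 10 powr n) * chain_const n \<delta> p \<kappa> powr - (q / p)"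
  shows "(\<integral>\<^sup>+x\<in>D. ennreal (\<bar>f x\<bar> powr q) \<partial>lborel) \<le> ennreal (C * E powr (q / p))"
proof -
  let ?T = "\<lambda>i x. band_truncation (int_decode i) \<bar>f x\<bar>"
  let ?a = "n + \<delta> * p"
  define \<sigma> where "\<sigma> = \<delta> * p / (n - \<delta> * p)"
  have q_pos: "0 < q" unfolding q using par by (intro divide_pos_pos) (auto simp: n_def)
  have q\<sigma>: "1 + \<sigma> = q / p" "p * (1 + \<sigma>) = q"
    unfolding \<sigma>_def q using par by (auto simp: field_simps)
  \<comment> \<open>The weak-type estimate requires a positive bound; if the energy vanishes, any positive number will do.\<close>
  define E' where "E' = (if E = 0 then 1 else E)"
  have E': "0 < E'" "E \<le> E'" "E' powr \<sigma> * E = E powr (q / p)"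
    using E(1) by (auto simp: E'_def q\<sigma>(1)[symmetric] powr_add)
  define W where "W = (1 + unit_ball_vol n * 10 powr n) * chain_const n \<delta> p \<kappa> powr - (1 + \<sigma>)"
  have W: "0 \<le> W" by (simp add: W_def n_def)
  have [measurable]: "frac_density N ?a p (?T i) \<in> borel_measurable borel" for i
    using N by (intro borel_measurable_frac_density) auto
  have energy: "(\<Sum>i. \<integral>\<^sup>+y\<in>D. frac_density N ?a p (?T i) y \<partial>lborel) \<le> ennreal E"
  proof -
    have "(\<Sum>i. \<integral>\<^sup>+y\<in>D. frac_density N ?a p (?T i) y \<partial>lborel) =
        (\<integral>\<^sup>+y. (\<Sum>i. frac_density N ?a p (?T i) y * indicator D y) \<partial>lborel)"
      by (intro nn_integral_suminf[symmetric]) measurable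
    also have "\<dots> \<le> (\<integral>\<^sup>+y\<in>D. frac_density N ?a p f y \<partial>lborel)"
      using N par by (intro nn_integral_mono) (auto simp: indicator_def intro!: suminf_frac_density_band_truncation_le)
    finally show ?thesis by (simp add: E)
  qed
  have level: "ennreal (2 powr ((int_decode i + 2) * q)) * emeasure lborel {x \<in> D. ?T i x = 2 powr int_decode i} \<le>
      ennreal (4 powr q * W * E' powr \<sigma>) * (\<integral>\<^sup>+y\<in>D. frac_density N ?a p (?T i) y \<partial>lborel)" for i
  proof -
    let ?k = "int_decode i"
    have "(\<integral>\<^sup>+y\<in>D. frac_density N ?a p (?T i) y \<partial>lborel) \<le> (\<Sum>i. \<integral>\<^sup>+y\<in>D. frac_density N ?a p (?T i) y \<partial>lborel)"
      by (rule term_le_suminf)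
    also note energy
    also have "ennreal E \<le> ennreal E'" using E' by (intro ennreal_leI)
    finally have "(\<integral>\<^sup>+y\<in>D. frac_density N ?a p (?T i) y \<partial>lborel) \<le> ennreal E'" .
    moreover have "emeasure lborel {x. ?T i x \<noteq> 0} < \<infinity>"
    proof -
      have "emeasure lborel {x. ?T i x \<noteq> 0} \<le> emeasure lborel {x. f x \<noteq> 0}"
        by (intro emeasure_mono) auto
      then show ?thesis using supp by (rule le_less_trans)
    qed
    ultimately have "emeasure lborel {x \<in> D. ?T i x = 2 powr ?k} \<le>
        ennreal (W * E' powr \<sigma> * (2 powr ?k) powr - q) * (\<integral>\<^sup>+y\<in>D. frac_density N ?a p (?T i) y \<partial>lborel)"
      unfolding W_def q\<sigma>(2)[symmetric] n_def using par chains E'(1) D N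
      by (intro weak_type_estimate[where \<kappa>=\<kappa> and D=D and E=E']) (auto simp: n_def \<sigma>_def band_truncation_bounds)
    then have "ennreal (2 powr ((?k + 2) * q)) * emeasure lborel {x \<in> D. ?T i x = 2 powr ?k} \<le>
        ennreal (2 powr ((?k + 2) * q)) * (ennreal (W * E' powr \<sigma> * (2 powr ?k) powr - q) *
          (\<integral>\<^sup>+y\<in>D. frac_density N ?a p (?T i) y \<partial>lborel))"
      by (intro mult_left_mono) auto
    also have "\<dots> = ennreal (2 powr ((?k + 2) * q) * (W * E' powr \<sigma> * (2 powr ?k) powr - q)) *
          (\<integral>\<^sup>+y\<in>D. frac_density N ?a p (?T i) y \<partial>lborel)"
      using W by (subst ennreal_mult) (auto simp: mult.assoc)
    also have "2 powr ((?k + 2) * q) * (W * E' powr \<sigma> * (2 powr ?k) powr - q) =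
        (2 powr ((?k + 2) * q) * (2 powr ?k) powr - q) * W * E' powr \<sigma>"
      by (simp add: mult_ac)
    also have "2 powr ((?k + 2) * q) * (2 powr ?k) powr - q = 2 powr (2 * q)"
      by (simp add: powr_powr powr_add[symmetric] algebra_simps)
    also have "2 powr (2 * q) = 4 powr q"
      by (simp add: powr_powr[symmetric])
    finally show ?thesis .
  qed
  have "(\<integral>\<^sup>+x\<in>D. ennreal (\<bar>f x\<bar> powr q) \<partial>lborel) \<le>
      (\<integral>\<^sup>+x. (\<Sum>i. ennreal (2 powr ((int_decode i + 2) * q)) * indicator {x \<in> D. ?T i x = 2 powr int_decode i} x) \<partial>lborel)"
  proof (intro nn_integral_mono)
    fix x
    show "ennreal (\<bar>f x\<bar> powr q) * indicator D x \<le>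
      (\<Sum>i. ennreal (2 powr ((int_decode i + 2) * q)) * indicator {x \<in> D. ?T i x = 2 powr int_decode i} x)"
    proof (cases "x \<in> D \<and> f x \<noteq> 0")
      case True
      then obtain k :: int where k: "2 powr (k + 1) \<le> \<bar>f x\<bar>" "\<bar>f x\<bar> \<le> 2 powr (k + 2)"
        using exists_dyadic_band[of "\<bar>f x\<bar>"] by auto
      define i where "i = int_encode k"
      have "band_truncation k \<bar>f x\<bar> = 2 powr k"
        using k(1) by (simp add: band_truncation_def powr_add)
      then have "x \<in> {x \<in> D. ?T i x = 2 powr int_decode i}"
        using True by (simp add: i_def)
      moreover have "\<bar>f x\<bar> powr q \<le> 2 powr ((int_decode i + 2) * q)"
        using k(2) q_pos powr_mono2[of q "\<bar>f x\<bar>" "2 powr (k + 2)"] by (simp add: i_def powr_powr)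
      ultimately have "ennreal (\<bar>f x\<bar> powr q) * indicator D x \<le>
          ennreal (2 powr ((int_decode i + 2) * q)) * indicator {x \<in> D. ?T i x = 2 powr int_decode i} x"
        using True by (simp add: ennreal_leI)
      also have "\<dots> \<le> (\<Sum>i. ennreal (2 powr ((int_decode i + 2) * q)) * indicator {x \<in> D. ?T i x = 2 powr int_decode i} x)"
        by (rule term_le_suminf)
      finally show ?thesis .
    qed auto
  qed
  also have "\<dots> = (\<Sum>i. ennreal (2 powr ((int_decode i + 2) * q)) * emeasure lborel {x \<in> D. ?T i x = 2 powr int_decode i})"
    by (subst nn_integral_suminf) (auto simp: nn_integral_cmult_indicator)
  also have "\<dots> \<le> (\<Sum>i. ennreal (4 powr q * W * E' powr \<sigma>) * (\<integral>\<^sup>+y\<in>D. frac_density N ?a p (?T i) y \<partial>lborel))"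
    by (intro suminf_le level) auto
  also have "\<dots> \<le> ennreal (4 powr q * W * E' powr \<sigma>) * ennreal E"
    unfolding ennreal_suminf_cmult by (intro mult_left_mono energy) auto
  also have "\<dots> = ennreal (4 powr q * W * (E' powr \<sigma> * E))"
    using W E by (subst ennreal_mult[symmetric]) (auto simp: mult.assoc)
  also have "4 powr q * W * (E' powr \<sigma> * E) = C * E powr (q / p)"
    unfolding E'(3) by (simp add: C W_def q\<sigma> mult_ac)
  finally show ?thesis .
qed

section \<open>Ball chains in unbounded John domains\<close>

text \<open>
A polygon inscribed in the curve up to time \<open>s\<close> can be prolonged by the chord from \<open>\<gamma>(s)\<close> to
\<open>\<gamma>(t)\<close>; its length is then at most \<open>t\<close>.  Taking the supremum over the polygons up to \<open>s\<close> replaces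
their length by \<open>s\<close>.
\<close>
lemma arc_length_param_dist_le:
  fixes \<gamma> :: "real \<Rightarrow> real^'n"
  assumes \<gamma>: "arc_length_param \<gamma> L" and st: "0 \<le> s" "s \<le> t" "t \<le> L"
  shows "dist (\<gamma> s) (\<gamma> t) \<le> t - s"
proof -
  have len: "curve_length \<gamma> 0 s = ennreal s" "curve_length \<gamma> 0 t = ennreal t"
    using \<gamma> st by (auto simp: arc_length_param_def)
  have poly: "(\<Sum>i<N. dist (\<gamma> (\<sigma> i)) (\<gamma> (\<sigma> (Suc i)))) + dist (\<gamma> s) (\<gamma> t) \<le> t"
    if \<sigma>: "mono \<sigma>" "range \<sigma> \<subseteq> {0..s}" for N and \<sigma> :: "nat \<Rightarrow> real"
  proof -
    \<comment> \<open>The polygon gets two further vertices, at the times \<open>s\<close> and \<open>t\<close>, and is constant afterwards.\<close>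
    define \<sigma>' where "\<sigma>' = (\<lambda>i. if i \<le> N then \<sigma> i else if i = Suc N then s else t)"
    have bnd: "0 \<le> \<sigma> i" "\<sigma> i \<le> s" for i
      using \<sigma>(2) rangeI[of \<sigma> i] by (auto simp: subset_iff)
    have bnd_t: "\<sigma> i \<le> t" for i
      using bnd(2)[of i] st by simp
    have "mono \<sigma>'"
      unfolding mono_def \<sigma>'_def using \<sigma>(1) bnd bnd_t st
      by (auto simp: mono_def)
    moreover have "range \<sigma>' \<subseteq> {0..t}"
      unfolding \<sigma>'_def using bnd bnd_t st by auto
    ultimately have "ennreal (\<Sum>i<N + 2. dist (\<gamma> (\<sigma>' i)) (\<gamma> (\<sigma>' (Suc i)))) \<le> curve_length \<gamma> 0 t"
      unfolding curve_length_def by (intro SUP_upper2[where i="(N + 2, \<sigma>')"]) auto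
    then have "(\<Sum>i<N + 2. dist (\<gamma> (\<sigma>' i)) (\<gamma> (\<sigma>' (Suc i)))) \<le> t"
      using len st by (subst (asm) len, subst (asm) ennreal_le_iff) auto
    moreover have "(\<Sum>i<N + 2. dist (\<gamma> (\<sigma>' i)) (\<gamma> (\<sigma>' (Suc i)))) =
      (\<Sum>i<N. dist (\<gamma> (\<sigma> i)) (\<gamma> (\<sigma> (Suc i)))) + dist (\<gamma> (\<sigma> N)) (\<gamma> s) + dist (\<gamma> s) (\<gamma> t)"
      by (simp add: \<sigma>'_def)
    ultimately show ?thesis
      by (smt (verit) zero_le_dist)
  qed
  have "dist (\<gamma> s) (\<gamma> t) \<le> t"
    using poly[of "\<lambda>_. 0" 0] st by (auto simp: mono_def)
  have "curve_length \<gamma> 0 s \<le> ennreal (t - dist (\<gamma> s) (\<gamma> t))"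
    unfolding curve_length_def
  proof (rule SUP_least)
    fix q :: "nat \<times> (nat \<Rightarrow> real)"
    assume "q \<in> {(N, \<sigma>). mono \<sigma> \<and> range \<sigma> \<subseteq> {0..s}}"
    then obtain N \<sigma> where "q = (N, \<sigma>)" "mono \<sigma>" "range \<sigma> \<subseteq> {0..s}"
      by (cases q) auto
    then show "(case q of (N, s) \<Rightarrow> ennreal (\<Sum>i<N. dist (\<gamma> (s i)) (\<gamma> (s (Suc i)))))
        \<le> ennreal (t - dist (\<gamma> s) (\<gamma> t))"
      using poly[of \<sigma> N] by (auto intro!: ennreal_leI)
  qed
  then show ?thesis
    using len \<open>dist (\<gamma> s) (\<gamma> t) \<le> t\<close> st by (auto simp: ennreal_le_iff)
qed

lemma boundary_dist_diff_le:
  assumes "ereal r \<le> boundary_dist G x"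
  shows "ereal (r - dist x y) \<le> boundary_dist G y"
proof (cases "frontier G = {}")
  case False
  then show ?thesis
    using assms infdist_triangle[of x "frontier G" y] by (simp add: boundary_dist_def)
qed (simp add: boundary_dist_def)

lemma boundary_dist_ball_subset:
  assumes "x \<in> G" "ereal r \<le> boundary_dist G x"
  shows "ball x r \<subseteq> G"
proof (rule ccontr)
  assume "\<not> ball x r \<subseteq> G"
  then have ne: "ball x r - G \<noteq> {}" by auto
  then have "r > 0"
    by (metis Diff_eq_empty_iff ball_eq_empty empty_subsetI not_le)
  then have "ball x r \<inter> G \<noteq> {}" using assms centre_in_ball by blast
  with ne have "ball x r \<inter> frontier G \<noteq> {}"
    using connected_Int_frontier connected_ball by blast
  then obtain y where y: "dist x y < r" "y \<in> frontier G" by auto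
  then have "infdist x (frontier G) < r"
    using infdist_le[of y "frontier G" x] by simp
  then show False
    using assms(2) y by (auto simp: boundary_dist_def split: if_splits)
qed

text \<open>
Unboundedness provides a John curve from \<open>x\<close> that is as long as desired, and on its first half
\<open>dist(\<gamma>(s), \<partial>D) \<ge> s / c\<close>.  Together with the bound \<open>dist(\<gamma>(s), \<partial>D) \<ge> r - s\<close> near the starting
point this gives \<open>dist(\<gamma>(s), \<partial>D) \<ge> (r + s) / (2 (1 + c))\<close> for every \<open>s\<close> up to half the length, so that
the parameters \<open>s\<^sub>i = r (1 + \<kappa>)\<^sup>i - r\<close> serve for all scales at once.
\<close>
lemma john_domain_chain:
  fixes D :: "(real^'n) set"
  assumes D: "john_domain c D" "\<not> bounded D" and "0 < c" and x: "x \<in> D"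
    and r: "0 < r" "ereal r \<le> boundary_dist D x" and \<kappa>: "0 < \<kappa>"
  shows "\<exists>z. z 0 = x \<and>
    (\<forall>i\<le>I. z i \<in> D \<and> ereal (r * (1 + \<kappa>) ^ i / (2 * (1 + c))) \<le> boundary_dist D (z i) \<and>
        dist x (z i) \<le> r * (1 + \<kappa>) ^ i) \<and>
    (\<forall>i<I. dist (z i) (z (Suc i)) \<le> \<kappa> * (r * (1 + \<kappa>) ^ i))"
proof -
  define s where "s i = r * (1 + \<kappa>) ^ i - r" for i :: nat
  have s_mono: "s i \<le> s j" if "i \<le> j" for i j
    using that r \<kappa> by (auto simp: s_def intro!: mult_left_mono power_increasing)
  have s0: "s 0 = 0" by (simp add: s_def)
  have s_nonneg: "0 \<le> s i" for i
    using s_mono[of 0 i] s0 by simp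
  obtain y where y: "y \<in> D" "dist x y > 2 * s I"
    using D(2) unfolding bounded_def by (meson not_le)
  then obtain \<gamma> L where \<gamma>: "arc_length_param \<gamma> L" "\<gamma> ` {0..L} \<subseteq> D" "\<gamma> 0 = x" "\<gamma> L = y"
    and john: "\<And>t. t \<in> {0..L} \<Longrightarrow> ereal (min t (L - t) / c) \<le> boundary_dist D (\<gamma> t)"
    using D(1) x unfolding john_domain_def by metis
  have "0 \<le> L" using \<gamma>(1) by (simp add: arc_length_param_def)
  then have "dist x y \<le> L"
    using arc_length_param_dist_le[OF \<gamma>(1), of 0 L] \<gamma> by simp
  with y have L: "2 * s I < L" by simp
  have half: "s i \<le> L - s i" "s i \<in> {0..L}" if "i \<le> I" for i
    using L s_mono[OF that] s_nonneg[of i] by auto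
  show ?thesis
  proof (intro exI[of _ "\<lambda>i. \<gamma> (s i)"] conjI allI impI)
    show "\<gamma> (s 0) = x" using s0 \<gamma> by simp
  next
    fix i assume i: "i \<le> I"
    show "\<gamma> (s i) \<in> D" using half[OF i] \<gamma>(2) by auto
    have dx: "dist x (\<gamma> (s i)) \<le> s i"
      using arc_length_param_dist_le[OF \<gamma>(1), of 0 "s i"] half[OF i] \<gamma>(3) by auto
    then show "dist x (\<gamma> (s i)) \<le> r * (1 + \<kappa>) ^ i" using r by (simp add: s_def)
    have 1: "ereal (s i / c) \<le> boundary_dist D (\<gamma> (s i))"
      using john[of "s i"] half[OF i] by (simp add: min_absorb1)
    have 2: "ereal (r - s i) \<le> boundary_dist D (\<gamma> (s i))"
      using boundary_dist_diff_le[OF r(2), of "\<gamma> (s i)"] dx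
      by (meson diff_left_mono ereal_less_eq(3) order_trans)
    show "ereal (r * (1 + \<kappa>) ^ i / (2 * (1 + c))) \<le> boundary_dist D (\<gamma> (s i))"
    proof (cases "frontier D = {}")
      case False
      define d where "d = infdist (\<gamma> (s i)) (frontier D)"
      have "s i \<le> c * d" "r - s i \<le> d" "0 \<le> d"
        using 1 2 False \<open>0 < c\<close> by (auto simp: boundary_dist_def d_def field_simps infdist_nonneg)
      then have "r * (1 + \<kappa>) ^ i \<le> d * (2 * (1 + c))"
        using mult_nonneg_nonneg[of c d] \<open>0 < c\<close> by (simp add: s_def algebra_simps)
      with \<open>0 < c\<close> False show ?thesis
        by (simp add: boundary_dist_def d_def pos_divide_le_eq)
    qed (simp add: boundary_dist_def)
  next
    fix i assume i: "i < I"
    have "dist (\<gamma> (s i)) (\<gamma> (s (Suc i))) \<le> s (Suc i) - s i"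
      using half[of "Suc i"] half[of i] s_mono[of i "Suc i"] i
      by (intro arc_length_param_dist_le[OF \<gamma>(1)]) auto
    then show "dist (\<gamma> (s i)) (\<gamma> (s (Suc i))) \<le> \<kappa> * (r * (1 + \<kappa>) ^ i)"
      by (simp add: s_def algebra_simps)
  qed
qed


definition fractional_nbhd :: "real \<Rightarrow> (real^'n) set \<Rightarrow> real^'n \<Rightarrow> (real^'n) set" where
  "fractional_nbhd \<tau> D x = {y. ereal (dist x y) < ereal \<tau> * boundary_dist D x}"

lemma fractional_nbhdI:
  assumes "dist x y < \<tau> * r" "ereal r \<le> boundary_dist D x" "0 \<le> \<tau>"
  shows "y \<in> fractional_nbhd \<tau> D x"
proof -
  have "ereal (dist x y) < ereal \<tau> * ereal r"
    using assms by simp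
  also have "\<dots> \<le> ereal \<tau> * boundary_dist D x"
    using assms by (intro ereal_mult_left_mono) auto
  finally show ?thesis by (simp add: fractional_nbhd_def)
qed

lemma fractional_nbhd_measurable:
  assumes "0 < \<tau>"
  shows "{(x, y). y \<in> fractional_nbhd \<tau> (D :: (real^'n) set) x} \<in> sets (borel \<Otimes>\<^sub>M borel)"
proof (cases "frontier D = {}")
  case True
  then have eq: "{(x, y). y \<in> fractional_nbhd \<tau> D x} = UNIV"
    using assms by (auto simp: fractional_nbhd_def boundary_dist_def)
  show ?thesis
    unfolding eq borel_prod by simp
next
  case False
  then have "{(x, y). y \<in> fractional_nbhd \<tau> D x} =
      {z. dist (fst z) (snd z) < \<tau> * infdist (fst z) (frontier D)}"
    by (auto simp: fractional_nbhd_def boundary_dist_def)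
  also have "open \<dots>"
    by (intro open_Collect_less continuous_intros)
  finally show ?thesis
    unfolding borel_prod by (rule borel_open)
qed

lemma boundary_dist_pos:
  assumes "open D" "x \<in> D"
  obtains r where "0 < r" "ereal r \<le> boundary_dist D x"
proof (cases "frontier D = {}")
  case True
  then show ?thesis using that[of 1] by (simp add: boundary_dist_def)
next
  case False
  have "x \<notin> frontier D" using assms by (auto simp: frontier_def interior_open)
  then have "0 < infdist x (frontier D)"
    using False infdist_pos_not_in_closed by (metis frontier_closed)
  then show ?thesis using that False by (simp add: boundary_dist_def)
qed

text \<open>
Points \<open>y\<close> of the \<open>i\<close>-th ball have distance at least \<open>\<rho>\<^sub>i / (4 (1 + c))\<close> to the boundary, and points of
the next ball are closer to \<open>y\<close> than \<open>4 \<kappa> \<rho>\<^sub>i\<close>.  The value of \<open>\<kappa>\<close> makes the latter number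
\<open>\<tau>\<close> times the former.
\<close>
lemma john_domain_ball_chain:
  fixes D :: "(real^'n) set"
  assumes D: "john_domain c D" "\<not> bounded D" and c: "1 \<le> c" and x: "x \<in> D"
    and \<tau>: "0 < \<tau>" "\<tau> < 1" and \<kappa>: "\<kappa> = \<tau> / (16 * (1 + c))"
    and r: "0 < r" "ereal r \<le> boundary_dist D x"
  shows "\<exists>z. ball_chain (fractional_nbhd \<tau> D) D \<kappa> r I x z"
proof -
  have \<kappa>0: "0 < \<kappa>" "\<kappa> < 1" "\<kappa> < \<tau>"
    using \<tau> c by (auto simp: \<kappa> divide_less_eq mult_less_cancel_left_pos intro: less_le_trans[of _ "16 * 1"])
  define \<rho> where "\<rho> i = r * (1 + \<kappa>) ^ i" for i
  have \<rho>: "0 < \<rho> i" "\<rho> (Suc i) = \<rho> i + \<kappa> * \<rho> i" "\<rho> 0 = r" for i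
    using r \<kappa>0 by (auto simp: \<rho>_def algebra_simps intro!: mult_pos_pos)
  have \<kappa>\<rho>: "\<kappa> * \<rho> i < \<rho> i" "\<kappa> * (\<kappa> * \<rho> i) < \<kappa> * \<rho> i" "0 < \<kappa> * \<rho> i" for i
    using \<rho>(1)[of i] \<kappa>0 by auto
  obtain z where z0: "z 0 = x"
    and z: "\<And>i. i \<le> I \<Longrightarrow> z i \<in> D" "\<And>i. i \<le> I \<Longrightarrow> ereal (\<rho> i / (2 * (1 + c))) \<le> boundary_dist D (z i)"
       "\<And>i. i \<le> I \<Longrightarrow> dist x (z i) \<le> \<rho> i"
    and step: "\<And>i. i < I \<Longrightarrow> dist (z i) (z (Suc i)) \<le> \<kappa> * \<rho> i"
    using john_domain_chain[OF D _ x r \<kappa>0(1), of I] c unfolding \<rho>_def by auto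
  have radius: "\<kappa> * \<rho> i \<le> \<rho> i / (4 * (1 + c))" "4 * \<kappa> * \<rho> i = \<tau> * (\<rho> i / (4 * (1 + c)))" for i
  proof -
    have "4 * (\<tau> / (16 * q)) * \<rho> i = \<tau> * (\<rho> i / (4 * q))" for q by simp
    then show *: "4 * \<kappa> * \<rho> i = \<tau> * (\<rho> i / (4 * (1 + c)))"
      unfolding \<kappa> .
    have "0 \<le> \<rho> i / (4 * (1 + c))" using c \<rho>(1)[of i] by simp
    then have "\<tau> * (\<rho> i / (4 * (1 + c))) \<le> 1 * (\<rho> i / (4 * (1 + c)))"
      using \<tau> by (intro mult_right_mono) auto
    with * \<kappa>\<rho>(3)[of i] show "\<kappa> * \<rho> i \<le> \<rho> i / (4 * (1 + c))" by linarith
  qed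
  have half: "\<rho> i / (4 * (1 + c)) + \<rho> i / (4 * (1 + c)) = \<rho> i / (2 * (1 + c))" for i
  proof -
    have "\<rho> i / (4 * q) + \<rho> i / (4 * q) = \<rho> i / (2 * q)" for q by simp
    then show ?thesis .
  qed
  show ?thesis
    unfolding ball_chain_def Let_def \<rho>_def[symmetric]
  proof (intro exI[of _ z] conjI allI impI ballI)
    show "ball (z 0) (\<kappa> * \<rho> 0) \<subseteq> fractional_nbhd \<tau> D x"
    proof
      fix w assume w: "w \<in> ball (z 0) (\<kappa> * \<rho> 0)"
      have "dist x w < \<kappa> * r" using w by (simp add: z0 \<rho>)
      also have "\<kappa> * r \<le> \<tau> * r" using \<kappa>0 r by simp
      finally show "w \<in> fractional_nbhd \<tau> D x"
        using r \<tau> by (intro fractional_nbhdI[of _ _ _ r]) auto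
    qed
  next
    fix i assume i: "i \<le> I"
    have "ereal (\<kappa> * \<rho> i) \<le> boundary_dist D (z i)"
      using z(2)[OF i] radius(1)[of i] half[of i] \<kappa>\<rho>(3)[of i]
      by (intro order_trans[OF _ z(2)[OF i]]) simp
    then have "ball (z i) (\<kappa> * \<rho> i) \<subseteq> D"
      using z(1)[OF i] boundary_dist_ball_subset by blast
    moreover have "ball (z i) (\<kappa> * \<rho> i) \<subseteq> ball x (2 * \<rho> i)"
      using z(3)[OF i] \<kappa>\<rho>(1)[of i] by (auto, metric)
    ultimately show "ball (z i) (\<kappa> * \<rho> i) \<subseteq> D \<inter> ball x (2 * \<rho> i)" by blast
  next
    fix i y assume i: "i < I" and y: "y \<in> ball (z i) (\<kappa> * \<rho> i)"
    have near: "dist y w < 4 * \<kappa> * \<rho> i" if "w \<in> ball (z (Suc i)) (\<kappa> * \<rho> (Suc i))" for w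
    proof -
      have "dist y w \<le> dist (z i) y + dist (z i) (z (Suc i)) + dist (z (Suc i)) w"
        by metric
      also have "\<dots> < \<kappa> * \<rho> i + \<kappa> * \<rho> i + \<kappa> * \<rho> (Suc i)"
        using y that step[OF i] by simp
      also have "\<dots> = 3 * (\<kappa> * \<rho> i) + \<kappa> * (\<kappa> * \<rho> i)"
        by (simp add: \<rho> algebra_simps)
      also have "\<dots> < 4 * \<kappa> * \<rho> i" using \<kappa>\<rho>(2)[of i] by simp
      finally show ?thesis .
    qed
    have "ereal (\<rho> i / (2 * (1 + c)) - dist (z i) y) \<le> boundary_dist D y"
      using i by (intro boundary_dist_diff_le z) simp
    moreover have "\<rho> i / (4 * (1 + c)) \<le> \<rho> i / (2 * (1 + c)) - dist (z i) y"
      using radius(1)[of i] half[of i] y by simp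
    ultimately have "ereal (\<rho> i / (4 * (1 + c))) \<le> boundary_dist D y"
      by (meson ereal_less_eq(3) order_trans)
    then show "ball (z (Suc i)) (\<kappa> * \<rho> (Suc i)) \<subseteq> fractional_nbhd \<tau> D y"
      using near radius(2) \<tau> by (auto intro!: fractional_nbhdI)
    fix w assume "w \<in> ball (z (Suc i)) (\<kappa> * \<rho> (Suc i))"
    then show "dist y w \<le> 4 * \<kappa> * \<rho> i" using near by (simp add: less_imp_le)
  qed (fact z0)
qed

section \<open>The fractional Sobolev inequality\<close>

lemma fractional_nbhd_subset:
  fixes D :: "(real^'n) set"
  assumes "x \<in> D" "0 < \<tau>" "\<tau> < 1"
  shows "fractional_nbhd \<tau> D x \<subseteq> D"
proof (cases "frontier D = {}")
  case True
  then have "D = UNIV" using assms by (auto simp: frontier_eq_empty)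
  then show ?thesis by simp
next
  case False
  define d where "d = infdist x (frontier D)"
  have "ball x d \<subseteq> D"
    using assms False by (intro boundary_dist_ball_subset) (auto simp: boundary_dist_def d_def)
  moreover have "fractional_nbhd \<tau> D x = ball x (\<tau> * d)"
    using False by (auto simp: fractional_nbhd_def boundary_dist_def d_def)
  moreover have "\<tau> * d \<le> d"
    using assms mult_right_mono[of \<tau> 1 d] by (simp add: d_def infdist_nonneg)
  ultimately show ?thesis
    using subset_ball by blast
qed

text \<open>
Allows \<open>u\<close> to be replaced by a Borel representative.  The neighbourhoods of points of \<open>D\<close> lie in \<open>D\<close>, so
values of \<open>u\<close> outside \<open>D\<close> never enter.
\<close>
lemma frac_energy_eq_integral_frac_density:
  fixes D :: "(real^'n) set"
  assumes \<tau>: "0 < \<tau>" "\<tau> < 1" and ae: "AE x in lborel. x \<in> D \<longrightarrow> u x = f x"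
  shows "frac_energy \<tau> \<delta> p D u =
    (\<integral>\<^sup>+x\<in>D. frac_density (fractional_nbhd \<tau> D) (real DIM(real^'n) + \<delta> * p) p f x \<partial>lborel)"
  unfolding frac_energy_def nn_integral_completion
proof (rule nn_integral_cong_AE, rule AE_mp[OF ae], rule AE_I2, rule impI)
  fix x assume x: "x \<in> D \<longrightarrow> u x = f x"
  show "(\<integral>\<^sup>+y\<in>{y. ereal (dist x y) < ereal \<tau> * boundary_dist D x}.
        ennreal (\<bar>u x - u y\<bar> powr p / norm (x - y) powr (real CARD('n) + \<delta> * p)) \<partial>lborel) * indicator D x =
      frac_density (fractional_nbhd \<tau> D) (real DIM(real^'n) + \<delta> * p) p f x * indicator D x"
  proof (cases "x \<in> D")
    case True
    have sub: "fractional_nbhd \<tau> D x \<subseteq> D"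
      using True \<tau> by (rule fractional_nbhd_subset)
    have "(\<integral>\<^sup>+y\<in>fractional_nbhd \<tau> D x.
        ennreal (\<bar>u x - u y\<bar> powr p / norm (x - y) powr (real CARD('n) + \<delta> * p)) \<partial>lborel) =
      (\<integral>\<^sup>+y\<in>fractional_nbhd \<tau> D x.
        ennreal (\<bar>f x - f y\<bar> powr p / norm (x - y) powr (real CARD('n) + \<delta> * p)) \<partial>lborel)"
      using ae by (intro nn_integral_cong_AE, elim AE_mp) (use sub x True in \<open>auto simp: indicator_def\<close>)
    then show ?thesis
      by (simp add: frac_density_def fractional_nbhd_def)
  qed simp
qed

theorem theorem5p2:
  fixes c \<tau> \<delta> p n :: real
  assumes "n = real CARD('n::finite)" and "n \<ge> 2"
    and "c \<ge> 1"
    and "0 < \<tau>" and "\<tau> < 1"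
    and "0 < \<delta>" and "\<delta> < 1"
    and "1 \<le> p" and "p < n / \<delta>"
  shows "\<exists>C::real. C > 0 \<and>
    (\<forall>D :: (real^'n) set. john_domain c D \<and> \<not> bounded D \<longrightarrow>
      (\<forall>u \<in> frac_sobolev \<tau> \<delta> p D. compact_support_in D u \<longrightarrow>
        (\<integral>\<^sup>+x\<in>D. ennreal (\<bar>u x\<bar> powr (n * p / (n - \<delta> * p))) \<partial>lebesgue)
          \<le> ennreal (C * enn2real (frac_seminorm \<tau> \<delta> p D u) powr (n * p / (n - \<delta> * p)))))"
proof -
  define q where "q = n * p / (n - \<delta> * p)"
  define \<kappa> where "\<kappa> = \<tau> / (16 * (1 + c))"
  define C where "C = 4 powr q * (1 + unit_ball_vol n * 10 powr n) * chain_const n \<delta> p \<kappa> powr - (q / p)"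
  have n: "n = real DIM(real^'n)" using assms(1) by simp
  have \<delta>p: "\<delta> * p < n" using assms by (simp add: pos_less_divide_eq mult.commute)
  have \<kappa>: "0 < \<kappa>" using assms by (simp add: \<kappa>_def)
  have "0 < chain_const n \<delta> p \<kappa>"
    using assms \<delta>p \<kappa> by (intro chain_const_pos) auto
  moreover have "0 < 1 + unit_ball_vol n * 10 powr n"
    using assms(2) by (intro add_pos_nonneg) auto
  ultimately have "0 < C" by (simp add: C_def)
  moreover have "(\<integral>\<^sup>+x\<in>D. ennreal (\<bar>u x\<bar> powr q) \<partial>lebesgue)
      \<le> ennreal (C * enn2real (frac_seminorm \<tau> \<delta> p D u) powr q)"
    if D: "john_domain c D" "\<not> bounded D" and u: "u \<in> frac_sobolev \<tau> \<delta> p D" "compact_support_in D u"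
    for D :: "(real^'n) set" and u
  proof -
    have "open D" using D(1) by (simp add: john_domain_def)
    then have D_borel: "D \<in> sets borel" by simp
    define K where "K = closure {x \<in> D. u x \<noteq> 0}"
    have K: "compact K" using u(2) by (simp add: compact_support_in_def K_def)
    have u_meas: "u \<in> borel_measurable (lebesgue_on D)" and semi: "frac_seminorm \<tau> \<delta> p D u < \<infinity>"
      using u(1) by (auto simp: frac_sobolev_def)
    have "(\<lambda>x. if x \<in> D then u x else 0) \<in> borel_measurable lebesgue"
      using D_borel by (intro borel_measurable_if_I[OF u_meas]) auto
    then obtain f where f [measurable]: "f \<in> borel_measurable lborel"
      and ae: "AE x in lborel. (if x \<in> D then u x else 0) = f x"
      using completion_ex_borel_measurable_real by blast
    have ae_D: "AE x in lborel. x \<in> D \<longrightarrow> u x = f x"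
      using ae by (rule AE_mp) (auto intro!: AE_I2 split: if_splits)
    have "emeasure lborel {x. f x \<noteq> 0} \<le> emeasure lborel K"
    proof (rule emeasure_mono_AE)
      show "AE x in lborel. x \<in> {x. f x \<noteq> 0} \<longrightarrow> x \<in> K"
        using ae by (rule AE_mp) (auto intro!: AE_I2 closure_subset[THEN subsetD] simp: K_def split: if_splits)
    qed (use K in \<open>auto intro: borel_closed compact_imp_closed\<close>)
    also have "emeasure lborel K < \<infinity>"
      using K by (rule emeasure_compact_finite)
    finally have supp: "emeasure lborel {x. f x \<noteq> 0} < \<infinity>" .
    define E where "E = enn2real (frac_energy \<tau> \<delta> p D u)"
    have finite: "frac_energy \<tau> \<delta> p D u < \<infinity>"
      using semi by (auto simp: frac_seminorm_def top.not_eq_extremum split: if_splits)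
    have "(\<integral>\<^sup>+x\<in>D. frac_density (fractional_nbhd \<tau> D) (real DIM(real^'n) + \<delta> * p) p f x \<partial>lborel)
        = frac_energy \<tau> \<delta> p D u"
      using assms ae_D by (intro frac_energy_eq_integral_frac_density[symmetric]) auto
    also have "\<dots> = ennreal E"
      using finite by (simp add: E_def)
    finally have energy: "(\<integral>\<^sup>+x\<in>D. frac_density (fractional_nbhd \<tau> D) (real DIM(real^'n) + \<delta> * p) p f x \<partial>lborel)
        = ennreal E" .
    have "(\<integral>\<^sup>+x\<in>D. ennreal (\<bar>u x\<bar> powr q) \<partial>lebesgue) = (\<integral>\<^sup>+x\<in>D. ennreal (\<bar>f x\<bar> powr q) \<partial>lborel)"
      unfolding nn_integral_completion
      by (rule nn_integral_cong_AE, rule AE_mp[OF ae_D]) (auto simp: indicator_def)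
    also have "\<dots> \<le> ennreal (C * E powr (q / p))"
    proof (rule sobolev_inequality_of_ball_chains[where N="fractional_nbhd \<tau> D" and \<delta>=\<delta> and \<kappa>=\<kappa>])
      show "{(x, y). y \<in> fractional_nbhd \<tau> D x} \<in> sets (borel \<Otimes>\<^sub>M borel)"
        using assms by (intro fractional_nbhd_measurable)
      fix x assume x: "x \<in> D"
      obtain r\<^sub>0 where r0: "0 < r\<^sub>0" "ereal r\<^sub>0 \<le> boundary_dist D x"
        using boundary_dist_pos[OF \<open>open D\<close> x] .
      have "\<exists>z. ball_chain (fractional_nbhd \<tau> D) D \<kappa> r I x z" if "0 < r" "r \<le> r\<^sub>0" for r I
      proof (rule john_domain_ball_chain[OF D _ x _ _ \<kappa>_def that(1)])
        show "ereal r \<le> boundary_dist D x"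
          using that(2) r0(2) by (meson ereal_less_eq(3) order_trans)
      qed (use assms in auto)
      with r0(1) show "\<exists>r\<^sub>0>0. \<forall>r I. 0 < r \<longrightarrow> r \<le> r\<^sub>0 \<longrightarrow> (\<exists>z. ball_chain (fractional_nbhd \<tau> D) D \<kappa> r I x z)"
        by blast
    qed (use assms \<delta>p \<kappa> D_borel supp energy f in \<open>auto simp: q_def C_def E_def\<close>)
    also have "E powr (q / p) = enn2real (frac_seminorm \<tau> \<delta> p D u) powr q"
      using finite by (simp add: frac_seminorm_def E_def powr_powr)
    finally show ?thesis .
  qed
  ultimately show ?thesis
    unfolding q_def by blast
qed

end
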